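(* If $f\in\mathcal F_{\mathrm{CSSA}}$, then $$\inf_{g\in\mathcal M}\mathrm{KL}(f\|g)=0\iff\int_{\mathbb{R}^d}\|x\|^2f(x)\,\mathrm{d}x<\infty.$$
   Context: $\log_+t=\max\{\log t,0\}$ for $t>0$, $\log_+0=0$. Densities are w.r.t. Lebesgue measure; $F(A)=\int_Af\,\mathrm{d}x$; $\operatorname{supp}(f)=\{x:f(x)>0\}$. Comparison cubes are closed axis-aligned cubes; partition cubes may be half-open so as to be disjoint. "A cube of side $r$ with a vertex at $y$" means a closed axis-aligned cube of side length $r$ having $y$ as one of its vertices. A family of cubes of common side length is adjacent if they have pairwise disjoint interiors and the union of their closures is connected. Definition ($\mathcal F_{\mathrm{FSSA}}$): a density $f$ on $\mathbb{R}^d$ belongs to $\mathcal F_{\mathrm{FSSA}}$ if there exist, for each $m\ge1$, a partition $\operatorname{supp}(f)=A^{(m)}_0\sqcup A^{(m)}_1\sqcup\cdots\sqcup A^{(m)}_m$ in which $A^{(m)}_1,\dots,A^{(m)}_m$ are adjacent cubes of common side length $h_m>0$ and $A^{(m)}_0$ is the remainder, such that: (i) $f$ is continuous on $\operatorname{supp}(f)$ except on a set of $F$-measure zero; (ii) there exist $r>0$ and, for every $y\in\operatorname{supp}(f)$, a comparison cube $C(r,y)$ of side length $r$ containing $y$, such that $D_r(y)=\log\big(f(y)/\inf_{z\in C(r,y)}f(z)\big)$ is measurable on $\operatorname{supp}(f)$ and $\int_{\operatorname{supp}(f)}D_r\,\mathrm{d}F<\infty$; (iii) there exists $M\in\mathbb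 N$ such that for every $m\ge M$: (a) if $y\in A^{(m)}_0$ then $C(r,y)\cap A^{(m)}_0$ contains a cube of side $r/2$ with a vertex at $y$; (b) if $y\in\operatorname{supp}(f)\setminus A^{(m)}_0$ then $C(r,y)\cap(\operatorname{supp}(f)\setminus A^{(m)}_0)$ contains a cube of side $r/2$ with a vertex at $y$. Definition ($\mathcal F_{\mathrm{CSSA}}$): a density $f$ belongs to $\mathcal F_{\mathrm{CSSA}}$ if there exist a measurable partition $\operatorname{supp}(f)=\bigsqcup_{\ell\ge1}Y_\ell$ with $p_\ell=F(Y_\ell)$, and, for each $\ell$ with $p_\ell>0$, a scale $r_\ell>0$, comparison cubes $C_\ell(y)$ of side $r_\ell$ containing $y$ ($y\in Y_\ell$), and for every $m\ge1$ a partition $Y_\ell=A^{(m)}_{\ell,0}\sqcup\cdots\sqcup A^{(m)}_{\ell,m}$ with $A^{(m)}_{\ell,1},\dots,A^{(m)}_{\ell,m}$ adjacent cubes of common side $h_{\ell,m}>0$, such that for each $\ell$ with $p_\ell>0$ the normalized restriction $f_\ell=f\mathbf 1_{Y_\ell}/p_\ell$ satisfies the definition of $\mathcal F_{\mathrm{FSSA}}$ with these witnesses (scale $r_\ell$, cubes $C_\ell(y)$, these partitions), and, with $F_\ell$ the law of density $f_\ell$ and $D_\ell(y)=\log\big(f_\ell(y)/\inf_{z\in C_\ell(y)}f_\ell(z)\big)$ for $y\in Y_\ell$, one has $\sum_{\ell:p_\ell>0}p_\ell\int_{Y_\ell}D_\ell\,\mathrm{d}F_\ell<\infty$ and $\sum_{\ell:p_\ell>0}p_\ell\log_+(1/r_\ell)<\infty$.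 $\mathrm{KL}(f\|g)=\int f\log(f/g)\,\mathrm{d}x\in[0,\infty]$. $\mathcal M$ denotes the class of all finite Gaussian mixture densities on $\mathbb{R}^d$: $x\mapsto\sum_{j=1}^m\pi_j\varphi(x;\mu_j,\Sigma_j)$ with $m\in\mathbb N$, $\pi_j\ge0$, $\sum_j\pi_j=1$, $\mu_j\in\mathbb{R}^d$, $\Sigma_j\succ0$, $\varphi(\cdot;\mu,\Sigma)$ the $N(\mu,\Sigma)$ density. *)

theory Defs
  imports "HOL-Analysis.Analysis"
begin

definition is_density :: "(real^'n \<Rightarrow> real) \<Rightarrow> bool" where
  "is_density f \<longleftrightarrow> f \<in> borel_measurable lborel \<and> (\<forall>x. 0 \<le> f x)
     \<and> (\<integral>\<^sup>+ x. ennreal (f x) \<partial>lborel) = 1"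

definition supp :: "(real^'n \<Rightarrow> real) \<Rightarrow> (real^'n) set" where
  "supp f = {x. f x > 0}"

definition log_plus :: "real \<Rightarrow> real" where
  "log_plus t = max (ln t) 0"   (* only used for t > 0 *)

definition closed_cube :: "real \<Rightarrow> (real^'n) set \<Rightarrow> bool" where
  "closed_cube r Q \<longleftrightarrow> (\<exists>a. Q = cbox a (a + r *\<^sub>R One))"

definition cube_with_vertex :: "real \<Rightarrow> real^'n \<Rightarrow> (real^'n) set \<Rightarrow> bool" where
  "cube_with_vertex r y Q \<longleftrightarrow> (\<exists>a. Q = cbox a (a + r *\<^sub>R One)
       \<and> (\<forall>i\<in>Basis. y \<bullet> i = a \<bullet> i \<or> y \<bullet> i = a \<bullet> i + r))"

text \<open>partition cube of side h: an axis-aligned cube, possibly (half-)open, i.e. a Borel set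
  lying between the open and the closed cube\<close>
definition partition_cube :: "real \<Rightarrow> (real^'n) set \<Rightarrow> bool" where
  "partition_cube h A \<longleftrightarrow> A \<in> sets borel \<and>
     (\<exists>a. box a (a + h *\<^sub>R One) \<subseteq> A \<and> A \<subseteq> cbox a (a + h *\<^sub>R One))"

definition Dlog :: "(real^'n \<Rightarrow> real) \<Rightarrow> (real^'n \<Rightarrow> (real^'n) set) \<Rightarrow> real^'n \<Rightarrow> ennreal" where
  "Dlog g C y = (if Inf (g ` C y) \<le> 0 then \<infinity> else ennreal (ln (g y / Inf (g ` C y))))"

text \<open>A m i (1 \<le> i \<le> m) are the adjacent cubes of the m-th partition, side h m;
  the remainder is A_0^{(m)} = supp g - (A m 1 \<union> ... \<union> A m m).\<close>
definition remainder :: "(real^'n \<Rightarrow> real) \<Rightarrow> (nat \<Rightarrow> nat \<Rightarrow> (real^'n) set) \<Rightarrow> nat \<Rightarrow> (real^'n) set" where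
  "remainder g A m = supp g - (\<Union>i\<in>{1..m}. A m i)"

definition FSSA_witness ::
  "(real^'n \<Rightarrow> real) \<Rightarrow> real \<Rightarrow> (real^'n \<Rightarrow> (real^'n) set)
     \<Rightarrow> (nat \<Rightarrow> nat \<Rightarrow> (real^'n) set) \<Rightarrow> (nat \<Rightarrow> real) \<Rightarrow> bool" where
  "FSSA_witness g r C A h \<longleftrightarrow>
     \<comment> \<open>partitions: A m 1 .. A m m adjacent cubes of common side h m inside supp g\<close>
     (\<forall>m\<ge>1. h m > 0
        \<and> (\<forall>i\<in>{1..m}. partition_cube (h m) (A m i) \<and> A m i \<subseteq> supp g)
        \<and> (\<forall>i\<in>{1..m}. \<forall>j\<in>{1..m}. i \<noteq> j \<longrightarrow> A m i \<inter> A m j = {})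
        \<and> (\<forall>i\<in>{1..m}. \<forall>j\<in>{1..m}. i \<noteq> j \<longrightarrow> interior (A m i) \<inter> interior (A m j) = {})
        \<and> connected (\<Union>i\<in>{1..m}. closure (A m i)))
   \<comment> \<open>(i) continuity off an F-null set\<close>
   \<and> (\<exists>N \<in> sets lborel. (\<integral>\<^sup>+ x. ennreal (g x) * indicator N x \<partial>lborel) = 0
        \<and> (\<forall>x \<in> supp g - N. continuous (at x within supp g) g))
   \<comment> \<open>(ii) comparison cubes and integrability of D\<close>
   \<and> r > 0
   \<and> (\<forall>y \<in> supp g. closed_cube r (C y) \<and> y \<in> C y)
   \<and> (\<lambda>y. Dlog g C y * indicator (supp g) y) \<in> borel_measurable lborel
   \<and> (\<integral>\<^sup>+ y. ennreal (g y) * Dlog g C y * indicator (supp g) y \<partial>lborel) < \<infinity>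
   \<comment> \<open>(iii)\<close>
   \<and> (\<exists>M. \<forall>m\<ge>M. m \<ge> 1 \<longrightarrow>
        (\<forall>y \<in> remainder g A m. \<exists>Q. cube_with_vertex (r/2) y Q \<and> Q \<subseteq> C y \<inter> remainder g A m)
      \<and> (\<forall>y \<in> supp g - remainder g A m.
           \<exists>Q. cube_with_vertex (r/2) y Q \<and> Q \<subseteq> C y \<inter> (supp g - remainder g A m)))"

definition F_FSSA :: "(real^'n \<Rightarrow> real) set" where
  "F_FSSA = {f. is_density f \<and> (\<exists>r C A h. FSSA_witness f r C A h)}"

definition F_CSSA :: "(real^'n \<Rightarrow> real) set" where
  "F_CSSA = {f. is_density f \<and>
     (\<exists>(Y :: nat \<Rightarrow> (real^'n) set) (r :: nat \<Rightarrow> real) (C :: nat \<Rightarrow> real^'n \<Rightarrow> (real^'n) set)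
        (A :: nat \<Rightarrow> nat \<Rightarrow> nat \<Rightarrow> (real^'n) set) (h :: nat \<Rightarrow> nat \<Rightarrow> real).
       let p = (\<lambda>l. measure (density lborel (\<lambda>x. ennreal (f x))) (Y l));
           fl = (\<lambda>l x. f x * indicator (Y l) x / p l) in
       (\<forall>l. Y l \<in> sets lborel)
     \<and> disjoint_family Y
     \<and> (\<Union>l. Y l) = supp f
     \<and> (\<forall>l. p l > 0 \<longrightarrow> FSSA_witness (fl l) (r l) (C l) (A l) (h l))
     \<and> (\<Sum>l. if p l > 0 then ennreal (p l) *
              (\<integral>\<^sup>+ y. ennreal (fl l y) * Dlog (fl l) (C l) y * indicator (supp (fl l)) y \<partial>lborel)
            else 0) < \<infinity>
     \<and> summable (\<lambda>l. if p l > 0 then p l * log_plus (1 / r l) else 0))}"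

definition kl_integrand :: "(real^'n \<Rightarrow> real) \<Rightarrow> (real^'n \<Rightarrow> real) \<Rightarrow> real^'n \<Rightarrow> ereal" where
  "kl_integrand f g x = (if f x = 0 then 0 else if g x = 0 then \<infinity>
                         else ereal (f x * ln (f x / g x)))"

text \<open>KL(f||g) = \<integral> f log(f/g) dx, as (positive part) - (negative part) in the extended reals\<close>
definition KL :: "(real^'n \<Rightarrow> real) \<Rightarrow> (real^'n \<Rightarrow> real) \<Rightarrow> ereal" where
  "KL f g = enn2ereal (\<integral>\<^sup>+ x. e2ennreal (kl_integrand f g x) \<partial>lborel)
          - enn2ereal (\<integral>\<^sup>+ x. e2ennreal (- kl_integrand f g x) \<partial>lborel)"

definition pos_def_matrix :: "real^'n^'n \<Rightarrow> bool" where
  "pos_def_matrix S \<longleftrightarrow> transpose S = S \<and> (\<forall>v. v \<noteq> 0 \<longrightarrow> v \<bullet> (S *v v) > 0)"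

definition gauss_density :: "real^'n \<Rightarrow> real^'n^'n \<Rightarrow> real^'n \<Rightarrow> real" where
  "gauss_density \<mu> S x =
     exp (- (1/2) * ((x - \<mu>) \<bullet> (matrix_inv S *v (x - \<mu>))))
     / sqrt ((2 * pi) ^ CARD('n) * det S)"

definition gauss_mixtures :: "(real^'n \<Rightarrow> real) set" where
  "gauss_mixtures = {g. \<exists>(m::nat) (w :: nat \<Rightarrow> real) \<mu> S.
      (\<forall>j<m. w j \<ge> 0) \<and> (\<Sum>j<m. w j) = 1 \<and> (\<forall>j<m. pos_def_matrix (S j))
      \<and> g = (\<lambda>x. \<Sum>j<m. w j * gauss_density (\<mu> j) (S j) x)}"

end

(*
  Only two consequences of the hypotheses matter.  Writing f_l for the normalised piece on Y_l and
  r_l for its scale, f_l(y) is exp (D_l(y)) times the infimum of f_l over a cube of side r_l, and that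
  infimum is at most r_l^(-n) because f_l integrates to 1.  Hence log f <= D_l + n log_+ (1 / r_l) on
  Y_l, and the two summability conditions give integrability of f log_+ f.

  Upper bound: finite Gaussian mixtures s_n converge to f almost everywhere along a suitable sequence.
  Put g_n = (1 - d) s_n + d G with a fixed standard Gaussian G.  The component d G gives the majorant
  log (f / g_n) <= log_+ f + |x|^2 + const, which is f-integrable when the second moment is
  finite, so dominated convergence yields limsup KL(f || g_n) <= log (1 / (1 - d)).

  Lower bound: a Gaussian mixture g is at most K exp (- 2c |x|^2).  Comparing f with exp (- c |x|^2)
  through a - b <= a log (a / b) shows that c |x|^2 f is dominated by the positive part of
  f log (f / g) plus integrable terms, so KL(f || g) < infinity forces a finite second moment.
*)
theory Submission
  imports Defs "HOL-Probability.Distributions"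
begin

text \<open>KL is a difference of two integrals in the extended reals, and this shapes both
  directions. The inequality a - b <= a log (a / b), integrated for two functions of mass one,
  bounds the negative part by 1 and by the positive part; so the difference is never indeterminate,
  it is nonnegative, and it is finite only if the positive part is. This needs mass one for
  Gaussians with arbitrary covariance, hence the change of variables under invertible matrices.

  The mixtures s_n come from L1 approximation: convolve with a narrow Gaussian, then replace the
  continuum of centres by the finitely many values of a simple function. Both operations keep the
  total mass, so Scheffe's lemma turns pointwise convergence into L1 convergence, and a subsequence
  converges almost everywhere. These approximants need only isotropic covariances.

  Almost everywhere convergence alone says nothing about log (f / s_n), because s_n may be far
  smaller than f in the tails; a fixed component keeps - log g_n below a quadratic function
  independent of n.\<close>

section \<open>Change of variables under invertible matrices\<close>

lemma nn_integral_lborel_translation: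
  fixes c :: "'a::euclidean_space"
  assumes [measurable]: "\<phi> \<in> borel_measurable borel"
  shows "(\<integral>\<^sup>+x. \<phi> (c + x) \<partial>lborel) = (\<integral>\<^sup>+x. \<phi> x \<partial>lborel)"
  by (subst (2) lborel_distr_plus[of c, symmetric]) (simp add: nn_integral_distr)

text \<open>The coordinate along \<open>u\<close> is integrated innermost. With the other
  coordinates fixed, among them the one along \<open>v\<close>, the shear is a translation in that
  single variable.\<close>

lemma nn_integral_lborel_shear:
  fixes u v :: "'a::euclidean_space"
  assumes [measurable]: "\<phi> \<in> borel_measurable borel"
    and u: "u \<in> Basis" and v: "v \<in> Basis" and uv: "u \<noteq> v"
  shows "(\<integral>\<^sup>+x. \<phi> (x + (x \<bullet> v) *\<^sub>R u) \<partial>lborel) = (\<integral>\<^sup>+x. \<phi> x \<partial>lborel)"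
proof -
  interpret product_sigma_finite "\<lambda>b::'a. lborel :: real measure" ..
  define I where "I = (Basis :: 'a set) - {u}"
  have I: "finite I" "u \<notin> I" "Basis = insert u I" "v \<in> I"
    using u v uv by (auto simp: I_def)
  define s where "s = (\<lambda>f. \<Sum>b\<in>I. f b *\<^sub>R b :: 'a)"
  have split: "(\<integral>\<^sup>+x. \<psi> x \<partial>lborel) =
      (\<integral>\<^sup>+f. (\<integral>\<^sup>+y. \<psi> (y *\<^sub>R u + s f) \<partial>lborel) \<partial>Pi\<^sub>M I (\<lambda>_. lborel))"
    if [measurable]: "\<psi> \<in> borel_measurable borel" for \<psi> :: "'a \<Rightarrow> ennreal"
  proof -
    have eq: "(\<Sum>b\<in>insert u I. (f(u := y)) b *\<^sub>R b) = y *\<^sub>R u + s f" for f y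
    proof -
      have "(\<Sum>b\<in>I. (f(u := y)) b *\<^sub>R b) = s f"
        using I(2) by (auto simp: s_def intro!: sum.cong)
      then show ?thesis using I(1,2) by (simp del: fun_upd_apply) simp
    qed
    have "(\<integral>\<^sup>+x. \<psi> x \<partial>lborel) =
        (\<integral>\<^sup>+f. \<psi> (\<Sum>b\<in>Basis. f b *\<^sub>R b) \<partial>Pi\<^sub>M Basis (\<lambda>_. lborel))"
      by (subst lborel_eq) (simp add: nn_integral_distr)
    also have "\<dots> = (\<integral>\<^sup>+f. \<psi> (\<Sum>b\<in>insert u I. f b *\<^sub>R b) \<partial>Pi\<^sub>M (insert u I) (\<lambda>_. lborel))"
      by (simp add: I(3))
    also have "\<dots> = (\<integral>\<^sup>+f. (\<integral>\<^sup>+y. \<psi> (\<Sum>b\<in>insert u I. (f(u := y)) b *\<^sub>R b) \<partial>lborel)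
        \<partial>Pi\<^sub>M I (\<lambda>_. lborel))"
      by (rule product_nn_integral_insert) (use I in auto)
    also have "\<dots> = (\<integral>\<^sup>+f. (\<integral>\<^sup>+y. \<psi> (y *\<^sub>R u + s f) \<partial>lborel) \<partial>Pi\<^sub>M I (\<lambda>_. lborel))"
      by (simp only: eq)
    finally show ?thesis .
  qed
  have sv: "s f \<bullet> v = f v" for f
  proof -
    have "s f \<bullet> v = (\<Sum>b\<in>I. f b * (b \<bullet> v))" by (simp add: s_def inner_sum_left)
    also have "\<dots> = (\<Sum>b\<in>I. if b = v then f b else 0)"
      using v by (intro sum.cong) (auto simp: inner_Basis I_def)
    finally show ?thesis using I by simp
  qed
  have "(\<integral>\<^sup>+x. \<phi> (x + (x \<bullet> v) *\<^sub>R u) \<partial>lborel) =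
      (\<integral>\<^sup>+f. (\<integral>\<^sup>+y. \<phi> ((y *\<^sub>R u + s f) + ((y *\<^sub>R u + s f) \<bullet> v) *\<^sub>R u) \<partial>lborel) \<partial>Pi\<^sub>M I (\<lambda>_. lborel))"
    by (rule split) simp
  also have "\<dots> = (\<integral>\<^sup>+f. (\<integral>\<^sup>+y. \<phi> ((f v + y) *\<^sub>R u + s f) \<partial>lborel) \<partial>Pi\<^sub>M I (\<lambda>_. lborel))"
    using u v uv by (intro nn_integral_cong arg_cong[where f=\<phi>])
      (simp add: inner_add_left sv inner_Basis algebra_simps)
  also have "\<dots> = (\<integral>\<^sup>+f. (\<integral>\<^sup>+y. \<phi> (y *\<^sub>R u + s f) \<partial>lborel) \<partial>Pi\<^sub>M I (\<lambda>_. lborel))"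
    by (intro nn_integral_cong nn_integral_lborel_translation) simp
  finally show ?thesis by (simp add: split)
qed

lemma prod_Basis_cart: "(\<Prod>b\<in>(Basis :: (real^'n) set). g b) = (\<Prod>i\<in>UNIV. g (axis i 1))"
  and sum_Basis_cart: "(\<Sum>b\<in>(Basis :: (real^'n) set). h b) = (\<Sum>i\<in>UNIV. h (axis i 1))"
  by (simp_all add: prod.reindex sum.reindex inj_on_def axis_eq_axis Basis_vec_def UNION_singleton_eq_range)

text \<open>The preimage of a box under a permutation of coordinates is a box with the same side
  lengths in another order, and boxes determine Lebesgue measure.\<close>

lemma nn_integral_lborel_swap:
  fixes \<phi> :: "real^'n \<Rightarrow> ennreal"
  assumes [measurable]: "\<phi> \<in> borel_measurable borel" and p: "p permutes (UNIV :: 'n set)"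
  shows "(\<integral>\<^sup>+x. \<phi> (\<chi> i. x $ p i) \<partial>lborel) = (\<integral>\<^sup>+x. \<phi> x \<partial>lborel)"
proof -
  let ?T = "\<lambda>x::real^'n. \<chi> i. x $ p i"
  have T: "?T \<in> borel_measurable borel"
    by (intro borel_measurable_continuous_onI continuous_intros)
  then have [measurable]: "?T \<in> lborel \<rightarrow>\<^sub>M borel" by simp
  have "lborel = distr lborel borel ?T"
  proof (rule lborel_eqI)
    fix l u :: "real^'n" assume lu: "\<And>b. b \<in> Basis \<Longrightarrow> l \<bullet> b \<le> u \<bullet> b"
    have le: "l $ i \<le> u $ i" for i
      using lu[of "axis i 1"] by (simp add: inner_axis axis_in_Basis_iff)
    let ?l = "\<chi> i. l $ inv p i" and ?u = "\<chi> i. u $ inv p i"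
    have "?T -` box l u = box ?l ?u"
    proof (intro set_eqI iffI)
      fix x assume "x \<in> ?T -` box l u"
      then have *: "l $ i < x $ p i \<and> x $ p i < u $ i" for i by (auto simp: mem_box_cart)
      show "x \<in> box ?l ?u"
        using *[of "inv p _"] p by (auto simp: mem_box_cart permutes_inverses)
    next
      fix x assume "x \<in> box ?l ?u"
      then have *: "l $ inv p i < x $ i \<and> x $ i < u $ inv p i" for i by (auto simp: mem_box_cart)
      show "x \<in> ?T -` box l u"
        using *[of "p _"] p by (auto simp: mem_box_cart permutes_inverses)
    qed
    then have "emeasure (distr lborel borel ?T) (box l u) = emeasure lborel (box ?l ?u)"
      by (simp add: emeasure_distr)
    also have "\<dots> = (\<Prod>i\<in>UNIV. (?u - ?l) $ i)"
    proof -
      have "\<forall>b\<in>Basis. ?l \<bullet> b \<le> ?u \<bullet> b" using le by (auto simp: Basis_vec_def inner_axis)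
      then show ?thesis by (simp add: emeasure_lborel_box_eq prod_Basis_cart inner_axis)
    qed
    also have "(\<Prod>i\<in>UNIV. (?u - ?l) $ i) = (\<Prod>i\<in>UNIV. (u - l) $ i)"
      using p by (intro prod.reindex_bij_witness[of _ p "inv p"]) (auto simp: permutes_inverses)
    also have "\<dots> = (\<Prod>b\<in>Basis. (u - l) \<bullet> b)"
      by (simp add: prod_Basis_cart inner_axis)
    finally show "emeasure (distr lborel borel ?T) (box l u) = (\<Prod>b\<in>Basis. (u - l) \<bullet> b)" .
  qed simp
  from arg_cong[OF this, of "\<lambda>M. integral\<^sup>N M \<phi>"] show ?thesis
    by (simp add: nn_integral_distr)
qed

text \<open>The linear change of variables in HOL-Analysis is only available for well-ordered index types.\<close>

theorem nn_integral_lborel_linear: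
  fixes \<phi> :: "real^'n \<Rightarrow> ennreal" and A :: "real^'n^'n"
  assumes "\<phi> \<in> borel_measurable borel" "det A \<noteq> 0"
  shows "\<bar>det A\<bar> * (\<integral>\<^sup>+x. \<phi> (A *v x) \<partial>lborel) = (\<integral>\<^sup>+x. \<phi> x \<partial>lborel)"
proof -
  have meas: "(\<lambda>x. B *v x) \<in> borel_measurable borel" for B :: "real^'n^'n"
    by (intro borel_measurable_continuous_onI linear_continuous_on) (simp add: linear_linear)
  \<comment> \<open>Induction over elementary matrices. The function is quantified inside the claim
    because in the product case the hypothesis for \<open>B\<close> is applied to the integrand
    composed with \<open>A\<close>. The condition on the determinant is a premise inside the claim
    so that the zero-row case becomes vacuous.\<close>
  have "det A \<noteq> 0 \<longrightarrow> (\<forall>\<phi> \<in> borel_measurable borel.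
      \<bar>det A\<bar> * (\<integral>\<^sup>+x. \<phi> (A *v x) \<partial>lborel) = (\<integral>\<^sup>+x. \<phi> x \<partial>lborel))"
  proof (rule induct_matrix_elementary_alt[of _ A])
    fix A B :: "real^'n^'n"
    let ?P = "\<lambda>A::real^'n^'n. det A \<noteq> 0 \<longrightarrow> (\<forall>\<phi> \<in> borel_measurable borel.
      \<bar>det A\<bar> * (\<integral>\<^sup>+x. \<phi> (A *v x) \<partial>lborel) = (\<integral>\<^sup>+x. \<phi> x \<partial>lborel))"
    assume A: "?P A" and B: "?P B"
    show "?P (A ** B)"
    proof (intro impI ballI)
      fix \<phi> :: "real^'n \<Rightarrow> ennreal" assume m: "\<phi> \<in> borel_measurable borel" and "det (A ** B) \<noteq> 0"
      then have nz: "det A \<noteq> 0" "det B \<noteq> 0" by (auto simp: det_mul)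
      have "(\<lambda>x. \<phi> (A *v x)) \<in> borel_measurable borel"
        by (rule measurable_compose[OF meas m])
      from B[rule_format, OF nz(2) this] A[rule_format, OF nz(1) m]
      show "\<bar>det (A ** B)\<bar> * (\<integral>\<^sup>+x. \<phi> ((A ** B) *v x) \<partial>lborel) = (\<integral>\<^sup>+x. \<phi> x \<partial>lborel)"
        by (simp add: det_mul abs_mult ennreal_mult matrix_vector_mul_assoc[symmetric] mult.assoc)
    qed
  next
    fix A :: "real^'n^'n" and i assume "row i A = 0"
    then have "det A = 0" by (rule det_zero_row)
    then show "det A \<noteq> 0 \<longrightarrow> (\<forall>\<phi> \<in> borel_measurable borel.
      \<bar>det A\<bar> * (\<integral>\<^sup>+x. \<phi> (A *v x) \<partial>lborel) = (\<integral>\<^sup>+x. \<phi> x \<partial>lborel))" by simp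
  next
    fix A :: "real^'n^'n" assume diag: "\<And>i j. i \<noteq> j \<Longrightarrow> A $ i $ j = 0"
    then have det: "det A = (\<Prod>i\<in>UNIV. A $ i $ i)" by (rule det_diagonal)
    show "det A \<noteq> 0 \<longrightarrow> (\<forall>\<phi> \<in> borel_measurable borel.
      \<bar>det A\<bar> * (\<integral>\<^sup>+x. \<phi> (A *v x) \<partial>lborel) = (\<integral>\<^sup>+x. \<phi> x \<partial>lborel))"
    proof (intro impI ballI)
      fix \<phi> :: "real^'n \<Rightarrow> ennreal" assume [measurable]: "\<phi> \<in> borel_measurable borel" and "det A \<noteq> 0"
      then have nz: "A $ i $ i \<noteq> 0" for i by (auto simp: det)
      \<comment> \<open>The diagonal entries, indexed by basis vectors instead of \<open>'n\<close>,
        as \<open>lborel_affine_euclidean\<close> expects them.\<close>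
      define c where "c b = b \<bullet> (A *v b)" for b
      have c: "c (axis i 1) = A $ i $ i" for i
        by (simp add: c_def inner_axis' matrix_vector_mult_basis column_def)
      \<comment> \<open>The summand 0 is the translation part of
        \<open>lborel_affine_euclidean\<close>, kept so that the map there can be rewritten to
        multiplication by \<open>A\<close>.\<close>
      have Ax: "0 + (\<Sum>j\<in>Basis. (c j * (x \<bullet> j)) *\<^sub>R j) = A *v x" for x
      proof -
        have "(\<Sum>j\<in>Basis. (c j * (x \<bullet> j)) *\<^sub>R j) = (\<Sum>i\<in>UNIV. (A $ i $ i * (x $ i)) *\<^sub>R axis i 1)"
          by (simp add: sum_Basis_cart inner_axis c)
        also have "\<dots> = A *v x"
        proof (intro vec_eq_iff[THEN iffD2] allI)
          fix k
          have "(A *v x) $ k = (\<Sum>j\<in>UNIV. if j = k then A $ k $ k * x $ k else 0)"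
            unfolding matrix_vector_mult_def vec_lambda_beta
            by (intro sum.cong) (auto simp: diag)
          then show "(\<Sum>i\<in>UNIV. (A $ i $ i * (x $ i)) *\<^sub>R axis i 1) $ k = (A *v x) $ k"
            by (simp add: axis_def if_distrib cong: if_cong)
        qed
        finally show ?thesis by simp
      qed
      have pr: "(\<Prod>j\<in>Basis. \<bar>c j\<bar>) = \<bar>det A\<bar>"
        by (simp add: det abs_prod prod_Basis_cart c)
      have "j \<in> Basis \<Longrightarrow> c j \<noteq> 0" for j using nz c by (auto simp: Basis_vec_def)
      from lborel_affine_euclidean[of c 0, OF this, unfolded Ax pr]
      have eq: "lborel = density (distr lborel borel ((*v) A)) (\<lambda>_. \<bar>det A\<bar>)" .
      show "\<bar>det A\<bar> * (\<integral>\<^sup>+x. \<phi> (A *v x) \<partial>lborel) = (\<integral>\<^sup>+x. \<phi> x \<partial>lborel)"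
        using meas[of A] by (subst (2) eq) (simp add: nn_integral_density nn_integral_distr nn_integral_cmult)
    qed
  next
    fix m n :: 'n assume "m \<noteq> n"
    let ?p = "Transposition.transpose m n"
    let ?A = "(\<chi> i j. mat 1 $ i $ ?p j) :: real^'n^'n"
    have p: "?p permutes UNIV" by (simp add: permutes_swap_id)
    have "?A = transpose (\<chi> i. (mat 1 :: real^'n^'n) $ ?p i)"
      by (auto simp: vec_eq_iff transpose_def mat_def)
    then have det: "\<bar>det ?A\<bar> = 1"
      using det_permute_rows[OF p, of "mat 1 :: real^'n^'n"]
      by (simp add: sign_def) 
    have "?A *v x = (\<chi> i. x $ ?p i)" for x
    proof (intro vec_eq_iff[THEN iffD2] allI)
      fix k
      have "(?A *v x) $ k = (\<Sum>j\<in>UNIV. if j = ?p k then x $ j else 0)"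
        unfolding matrix_vector_mult_def vec_lambda_beta
        by (intro sum.cong) (auto simp: mat_def)
      then show "(?A *v x) $ k = (\<chi> i. x $ ?p i) $ k" by simp
    qed
    then show "det ?A \<noteq> 0 \<longrightarrow> (\<forall>\<phi> \<in> borel_measurable borel.
      \<bar>det ?A\<bar> * (\<integral>\<^sup>+x. \<phi> (?A *v x) \<partial>lborel) = (\<integral>\<^sup>+x. \<phi> x \<partial>lborel))"
      using nn_integral_lborel_swap[OF _ p] det by simp
  next
    fix m n :: 'n assume mn: "m \<noteq> n"
    let ?A = "(\<chi> i j. of_bool (i = m \<and> j = n \<or> i = j)) :: real^'n^'n"
    have "?A = (\<chi> k. if k = m then row m (mat 1) + 1 *s row n (mat 1) else row k (mat 1))"
      using mn by (auto simp: vec_eq_iff row_def mat_def)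
    then have det: "det ?A = 1"
      using det_row_operation[OF mn, of "mat 1 :: real^'n^'n" 1] by simp
    have "?A *v x = x + (x \<bullet> axis n 1) *\<^sub>R axis m 1" for x
    proof (intro vec_eq_iff[THEN iffD2] allI)
      fix k
      have "(?A *v x) $ k = (\<Sum>j\<in>UNIV. (if j = k then x $ j else 0) + of_bool (k = m) * (if j = n then x $ j else 0))"
        unfolding matrix_vector_mult_def using mn by (auto intro!: sum.cong)
      then show "(?A *v x) $ k = (x + (x \<bullet> axis n 1) *\<^sub>R axis m 1) $ k"
        by (simp add: sum.distrib sum_distrib_left[symmetric] inner_axis) (simp add: axis_def)
    qed
    then show "det ?A \<noteq> 0 \<longrightarrow> (\<forall>\<phi> \<in> borel_measurable borel.
      \<bar>det ?A\<bar> * (\<integral>\<^sup>+x. \<phi> (?A *v x) \<partial>lborel) = (\<integral>\<^sup>+x. \<phi> x \<partial>lborel))"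
      using nn_integral_lborel_shear[of _ "axis m 1 :: real^'n" "axis n 1"] mn det
      by (simp add: axis_in_Basis_iff axis_eq_axis)
  qed
  with assms show ?thesis by blast
qed

section \<open>Gaussian densities with arbitrary covariance\<close>

text \<open>Gram-Schmidt for the inner product given by \<open>S\<close>. The index set grows by one
  element at a time, so that a single induction produces the whole family.\<close>

lemma pos_def_orthonormal_family:
  fixes S :: "real^'n^'n"
  assumes "pos_def_matrix S"
  shows "\<exists>b :: 'n \<Rightarrow> real^'n. \<forall>i\<in>I. \<forall>j\<in>I. b i \<bullet> (S *v b j) = of_bool (i = j)"
proof -
  have pos: "v \<noteq> 0 \<Longrightarrow> 0 < v \<bullet> (S *v v)" and sym: "x \<bullet> (S *v y) = y \<bullet> (S *v x)" for v x y
    using assms dot_lmul_matrix[of x S y] transpose_matrix_vector[of S x]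
    by (auto simp: pos_def_matrix_def inner_commute)
  have "finite I" by simp
  then show ?thesis
  proof (induction I)
    case empty
    show ?case by simp
  next
    case (insert k I)
    then obtain b where b: "\<And>i j. i \<in> I \<Longrightarrow> j \<in> I \<Longrightarrow> b i \<bullet> (S *v b j) = of_bool (i = j)"
      by blast
    \<comment> \<open>Since \<open>k\<close> is not yet indexed, fewer than n vectors are in use;
      they cannot span the space, which supplies a new vector \<open>v\<close>.\<close>
    have "I \<subset> UNIV" using insert.hyps by blast
    then have "card I < CARD('n)" by (simp add: psubset_card_mono)
    then have "dim (b ` I) < DIM(real^'n)"
      using dim_le_card'[of "b ` I"] card_image_le[of I b] insert.hyps by simp
    then have "span (b ` I) \<noteq> UNIV" by (metis dim_UNIV dim_span less_irrefl)
    then obtain v where v: "v \<notin> span (b ` I)" by blast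
    define w where "w = v - (\<Sum>j\<in>I. (b j \<bullet> (S *v v)) *\<^sub>R b j)"
    have "(\<Sum>j\<in>I. (b j \<bullet> (S *v v)) *\<^sub>R b j) \<in> span (b ` I)"
      by (intro span_sum span_scale span_base) simp
    with v have "w \<noteq> 0" by (auto simp: w_def)
    then have w: "0 < w \<bullet> (S *v w)" by (rule pos)
    have orth: "w \<bullet> (S *v b i) = 0" if "i \<in> I" for i
    proof -
      have "(\<Sum>j\<in>I. (b j \<bullet> (S *v v)) * (b j \<bullet> (S *v b i))) = (\<Sum>j\<in>I. if j = i then b j \<bullet> (S *v v) else 0)"
        using that by (intro sum.cong) (auto simp: b)
      then show ?thesis
        using that insert.hyps by (simp add: w_def inner_diff_left inner_sum_left sym[of v])
    qed
    have orth': "b i \<bullet> (S *v w) = 0" if "i \<in> I" for i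
      using orth[OF that] sym[of w] by simp
    define c where "c = 1 / sqrt (w \<bullet> (S *v w))"
    have c: "c * (c * (w \<bullet> (S *v w))) = 1"
      using w by (simp add: c_def field_simps)
    define b' where "b' = b(k := c *\<^sub>R w)"
    have "b' i \<bullet> (S *v b' j) = of_bool (i = j)" if "i \<in> insert k I" "j \<in> insert k I" for i j
      using that insert.hyps b orth c
      by (auto simp: b'_def matrix_vector_mult_scaleR orth')
    then show ?case by blast
  qed
qed

text \<open>If the columns of \<open>B\<close> are orthonormal for \<open>S\<close>, then the
  transpose of \<open>B\<close> times \<open>S\<close> times \<open>B\<close> is the identity. Hence
  the inverse of \<open>S\<close> is \<open>B\<close> times its transpose, and \<open>T\<close> is
  the transpose of \<open>B\<close>.\<close>

lemma pos_def_inverse_factor: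
  fixes S :: "real^'n^'n"
  assumes "pos_def_matrix S"
  obtains T :: "real^'n^'n" where "det T \<noteq> 0" "det S = 1 / (det T)\<^sup>2"
    "\<And>v. v \<bullet> (matrix_inv S *v v) = (norm (T *v v))\<^sup>2"
proof -
  obtain b :: "'n \<Rightarrow> real^'n" where b: "\<And>i j. b i \<bullet> (S *v b j) = of_bool (i = j)"
    using pos_def_orthonormal_family[OF assms, of UNIV] by blast
  define B :: "real^'n^'n" where "B = (\<chi> i j. b j $ i)"
  have eq: "transpose B ** (S ** B) = mat 1"
    using b by (simp add: vec_eq_iff matrix_matrix_mult_def matrix_vector_mult_def transpose_def
        mat_def inner_vec_def B_def of_bool_def)
  then have "det B * (det S * det B) = 1" by (metis det_I det_mul det_transpose)
  then have det: "det B \<noteq> 0" "det S = 1 / (det B)\<^sup>2" by (auto simp: eq_divide_eq power2_eq_square ac_simps)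
  have "(S ** B) ** transpose B = mat 1"
    using eq matrix_left_right_inverse by blast
  then have inv: "S ** (B ** transpose B) = mat 1" by (simp add: matrix_mul_assoc)
  then have inv': "(B ** transpose B) ** S = mat 1" using matrix_left_right_inverse by blast
  \<comment> \<open>\<open>matrix_inv\<close> is given by choice, so the existence of some two-sided
    inverse has to be shown before the chosen one can be identified by uniqueness.\<close>
  have "S ** matrix_inv S = mat 1 \<and> matrix_inv S ** S = mat 1"
    unfolding matrix_inv_def by (rule someI[of _ "B ** transpose B"]) (use inv inv' in auto)
  then have "matrix_inv S = B ** transpose B"
    using inv by (metis matrix_mul_assoc matrix_mul_lid matrix_mul_rid)
  then have "v \<bullet> (matrix_inv S *v v) = (norm (transpose B *v v))\<^sup>2" for v
    by (simp add: power2_norm_eq_inner matrix_vector_mul_assoc[symmetric] transpose_matrix_vector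
        dot_lmul_matrix)
  with det that[of "transpose B"] show ?thesis by simp
qed

lemma nn_integral_std_gaussian:
  "(\<integral>\<^sup>+x. ennreal (exp (- (1/2) * (norm (x :: 'a::euclidean_space))\<^sup>2)) \<partial>lborel) = ennreal (sqrt ((2 * pi) ^ DIM('a)))"
proof -
  have 1: "(\<integral>\<^sup>+x. ennreal (exp (- (1/2) * x\<^sup>2)) \<partial>lborel) = ennreal (sqrt (2 * pi))"
  proof -
    have "(\<integral>\<^sup>+x. ennreal (exp (- (1/2) * x\<^sup>2)) \<partial>lborel) =
        (\<integral>\<^sup>+x. ennreal (sqrt (2 * pi)) * ennreal (std_normal_density x) \<partial>lborel)"
      by (intro nn_integral_cong) (simp add: std_normal_density_def ennreal_mult[symmetric])
    also have "\<dots> = ennreal (sqrt (2 * pi)) * (\<integral>\<^sup>+x. ennreal (std_normal_density x) \<partial>lborel)"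
      by (rule nn_integral_cmult) simp
    also have "(\<integral>\<^sup>+x. ennreal (std_normal_density x) \<partial>lborel) = 1"
      by (subst nn_integral_eq_integral) auto
    finally show ?thesis by simp
  qed
  have "exp (- (1/2) * (norm x)\<^sup>2) = (\<Prod>b\<in>Basis. exp (- (1/2) * (x \<bullet> b)\<^sup>2))" for x :: 'a
  proof -
    have "(norm x)\<^sup>2 = (\<Sum>b\<in>Basis. (x \<bullet> b)\<^sup>2)"
      unfolding power2_norm_eq_inner by (subst euclidean_inner) (simp add: power2_eq_square)
    then show ?thesis by (simp only: sum_distrib_left exp_sum finite_Basis)
  qed
  then have "(\<integral>\<^sup>+x. ennreal (exp (- (1/2) * (norm (x :: 'a))\<^sup>2)) \<partial>lborel) =
      (\<integral>\<^sup>+x. (\<Prod>b\<in>Basis. ennreal (exp (- (1/2) * ((x :: 'a) \<bullet> b)\<^sup>2))) \<partial>lborel)"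
    by (simp add: prod_ennreal)
  also have "\<dots> = (\<Prod>b\<in>(Basis :: 'a set). (\<integral>\<^sup>+x. ennreal (exp (- (1/2) * x\<^sup>2)) \<partial>lborel))"
    by (rule nn_integral_lborel_prod) auto
  also have "\<dots> = ennreal (sqrt ((2 * pi) ^ DIM('a)))"
    unfolding 1 prod_constant by (simp only: ennreal_power real_sqrt_power real_sqrt_ge_zero pi_ge_zero mult_nonneg_nonneg zero_le_numeral)
  finally show ?thesis .
qed

text \<open>The normalising factor becomes the absolute determinant of \<open>T\<close>, which is
  precisely the Jacobian of the map that turns the exponent into the standard one.\<close>

lemma gauss_density_factor:
  fixes S :: "real^'n^'n"
  assumes "pos_def_matrix S"
  obtains T :: "real^'n^'n" where "det T \<noteq> 0"
    "\<And>\<mu> x. gauss_density \<mu> S x = \<bar>det T\<bar> / sqrt ((2 * pi) ^ CARD('n)) * exp (- (1/2) * (norm (T *v (x - \<mu>)))\<^sup>2)"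
proof -
  obtain T :: "real^'n^'n" where T: "det T \<noteq> 0" "det S = 1 / (det T)\<^sup>2"
    "\<And>v. v \<bullet> (matrix_inv S *v v) = (norm (T *v v))\<^sup>2"
    using pos_def_inverse_factor[OF assms] by metis
  show ?thesis
    by (rule that[OF T(1)]) (simp add: gauss_density_def T real_sqrt_divide field_simps)
qed

lemma gauss_density_pos: "pos_def_matrix S \<Longrightarrow> 0 < gauss_density \<mu> S x"
  by (rule gauss_density_factor[of S]) auto

text \<open>Continuity in the mean matters as much as in the point: the approximation below moves
  the centres of Gaussians while the point stays fixed.\<close>

lemma continuous_on_gauss_density [continuous_intros]:
  assumes "continuous_on A g" "continuous_on A h"
  shows "continuous_on A (\<lambda>x. gauss_density (g x) S (h x))"
  unfolding gauss_density_def divide_inverse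
  by (intro continuous_intros assms bounded_linear.continuous_on[OF matrix_vector_mul_bounded_linear])

lemma borel_measurable_gauss_density [measurable]: "gauss_density \<mu> S \<in> borel_measurable borel"
  by (intro borel_measurable_continuous_onI continuous_intros)

lemma nn_integral_gauss_density:
  fixes S :: "real^'n^'n"
  assumes "pos_def_matrix S"
  shows "(\<integral>\<^sup>+x. ennreal (gauss_density \<mu> S x) \<partial>lborel) = 1"
proof -
  obtain T :: "real^'n^'n" where T: "det T \<noteq> 0" "\<And>\<mu> x. gauss_density \<mu> S x =
      \<bar>det T\<bar> / sqrt ((2 * pi) ^ CARD('n)) * exp (- (1/2) * (norm (T *v (x - \<mu>)))\<^sup>2)"
    using gauss_density_factor[OF assms] by metis
  let ?c = "sqrt ((2 * pi) ^ CARD('n))"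
  have "(\<integral>\<^sup>+x. ennreal (gauss_density \<mu> S x) \<partial>lborel) = (\<integral>\<^sup>+x. ennreal (gauss_density \<mu> S (\<mu> + x)) \<partial>lborel)"
    by (rule nn_integral_lborel_translation[symmetric]) simp
  also have "\<dots> = (\<integral>\<^sup>+x. ennreal (1 / ?c) * (\<bar>det T\<bar> * ennreal (exp (- (1/2) * (norm (T *v x))\<^sup>2))) \<partial>lborel)"
    by (intro nn_integral_cong) (simp add: T ennreal_mult[symmetric])
  also have "\<dots> = ennreal (1 / ?c) * (\<bar>det T\<bar> * (\<integral>\<^sup>+x. ennreal (exp (- (1/2) * (norm (T *v x))\<^sup>2)) \<partial>lborel))"
  proof -
    have [measurable]: "(\<lambda>x. T *v x) \<in> borel_measurable borel"
      by (intro borel_measurable_continuous_onI linear_continuous_on) (simp add: linear_linear)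
    show ?thesis by (simp add: nn_integral_cmult)
  qed
  also have "\<bar>det T\<bar> * (\<integral>\<^sup>+x. ennreal (exp (- (1/2) * (norm (T *v x))\<^sup>2)) \<partial>lborel) =
      (\<integral>\<^sup>+x. ennreal (exp (- (1/2) * (norm (x :: real^'n))\<^sup>2)) \<partial>lborel)"
    by (rule nn_integral_lborel_linear[where \<phi>="\<lambda>x. ennreal (exp (- (1/2) * (norm x)\<^sup>2))"]) (use T in auto)
  also have "\<dots> = ennreal ?c" using nn_integral_std_gaussian[where 'a="real^'n"] by (simp only: DIM_cart DIM_real mult_1_right)
  also have "ennreal (1 / ?c) * ennreal ?c = 1"
    by (simp add: ennreal_mult[symmetric])
  finally show ?thesis .
qed

text \<open>An injective linear map satisfies |T v| >= B |v| for some B > 0. Shifting the centre to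
  the origin costs half of the quadratic term, since |x - m|^2 >= |x|^2 / 2 - |m|^2; together with
  the 1/2 in the exponent this gives the rate B^2 / 4.\<close>

lemma gauss_density_le_exp:
  fixes S :: "real^'n^'n"
  assumes "pos_def_matrix S"
  obtains K c where "0 < c" "\<And>x. gauss_density \<mu> S x \<le> K * exp (- c * (norm x)\<^sup>2)"
proof -
  obtain T :: "real^'n^'n" where T: "det T \<noteq> 0" "\<And>\<mu> x. gauss_density \<mu> S x =
      \<bar>det T\<bar> / sqrt ((2 * pi) ^ CARD('n)) * exp (- (1/2) * (norm (T *v (x - \<mu>)))\<^sup>2)"
    using gauss_density_factor[OF assms] by metis
  have "inj ((*v) T)" using T(1) invertible_det_nz invertible_eq_bij bij_is_inj by blast
  then obtain B where B: "0 < B" "\<And>x. B * norm x \<le> norm (T *v x)"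
    using linear_inj_bounded_below_pos[of "(*v) T"] by (auto simp: matrix_vector_mul_linear)
  let ?k = "\<bar>det T\<bar> / sqrt ((2 * pi) ^ CARD('n))"
  have *: "(norm x)\<^sup>2 / 2 - (norm \<mu>)\<^sup>2 \<le> (norm (x - \<mu>))\<^sup>2" for x
  proof -
    have "norm x \<le> norm (x - \<mu>) + norm \<mu>" using norm_triangle_ineq[of "x - \<mu>" \<mu>] by simp
    then have "(norm x)\<^sup>2 \<le> (norm (x - \<mu>) + norm \<mu>)\<^sup>2" by (simp add: power_mono)
    also have "\<dots> \<le> 2 * (norm (x - \<mu>))\<^sup>2 + 2 * (norm \<mu>)\<^sup>2" 
      using sum_squares_bound[of "norm (x - \<mu>)" "norm \<mu>"] by (simp add: power2_sum)
    finally show ?thesis by simp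
  qed
  have "gauss_density \<mu> S x \<le> (?k * exp (B\<^sup>2 / 2 * (norm \<mu>)\<^sup>2)) * exp (- (B\<^sup>2 / 4) * (norm x)\<^sup>2)" for x
  proof -
    have "B\<^sup>2 * ((norm x)\<^sup>2 / 2 - (norm \<mu>)\<^sup>2) \<le> B\<^sup>2 * (norm (x - \<mu>))\<^sup>2"
      using * by (rule mult_left_mono) simp
    also have "\<dots> = (B * norm (x - \<mu>))\<^sup>2" by (simp add: power_mult_distrib)
    also have "\<dots> \<le> (norm (T *v (x - \<mu>)))\<^sup>2" using B by (intro power_mono) auto
    finally have "- (1/2) * (norm (T *v (x - \<mu>)))\<^sup>2 \<le> B\<^sup>2 / 2 * (norm \<mu>)\<^sup>2 + - (B\<^sup>2 / 4) * (norm x)\<^sup>2"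
      by (simp add: algebra_simps)
    then have "exp (- (1/2) * (norm (T *v (x - \<mu>)))\<^sup>2) \<le> exp (B\<^sup>2 / 2 * (norm \<mu>)\<^sup>2) * exp (- (B\<^sup>2 / 4) * (norm x)\<^sup>2)"
      by (simp add: exp_add[symmetric])
    then show ?thesis unfolding T(2) mult.assoc by (rule mult_left_mono) simp
  qed
  from that[OF _ this] show ?thesis using B(1) by simp
qed

lemma
  fixes s :: real
  assumes s: "0 < s"
  shows pos_def_scalar: "pos_def_matrix (mat s :: real^'n^'n)"
    and gauss_density_scalar: "gauss_density \<mu> (mat s) x =
      exp (- (norm (x - \<mu> :: real^'n))\<^sup>2 / (2 * s)) / sqrt ((2 * pi * s) ^ CARD('n))"
proof -
  have mv: "mat t *v v = t *\<^sub>R v" for t and v :: "real^'n"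
    by (simp add: vec_eq_iff matrix_vector_mult_def mat_def if_distrib if_distribR cong: if_cong)
  have tr: "transpose (mat s) = (mat s :: real^'n^'n)" by (simp add: transpose_mat)
  with s show pd: "pos_def_matrix (mat s :: real^'n^'n)"
    by (simp add: pos_def_matrix_def mv)
  have mm: "mat t ** mat u = (mat (t * u) :: real^'n^'n)" for t u
    by (simp add: matrix_eq matrix_vector_mul_assoc[symmetric] mv)
  have *: "mat s ** mat (1 / s) = (mat 1 :: real^'n^'n)" "mat (1 / s) ** mat s = (mat 1 :: real^'n^'n)"
    using s by (simp_all add: mm)
  then have "mat s ** matrix_inv (mat s) = (mat 1 :: real^'n^'n)"
    unfolding matrix_inv_def by (rule someI2[of _ "mat (1 / s)", OF conjI]) auto
  then have inv: "matrix_inv (mat s) = (mat (1 / s) :: real^'n^'n)"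
    using * by (metis matrix_mul_assoc matrix_mul_lid matrix_mul_rid)
  have det: "det (mat s :: real^'n^'n) = s ^ CARD('n)"
    by (subst det_diagonal) (auto simp: mat_def)
  show "gauss_density \<mu> (mat s) x =
      exp (- (norm (x - \<mu> :: real^'n))\<^sup>2 / (2 * s)) / sqrt ((2 * pi * s) ^ CARD('n))"
    by (simp add: gauss_density_def inv mv det power2_norm_eq_inner power_mult_distrib mult.commute)
qed

lemma nn_integral_exp_neg_norm_square:
  fixes c :: real
  assumes c: "0 < c"
  shows "(\<integral>\<^sup>+x. ennreal (exp (- c * (norm (x :: real^'n))\<^sup>2)) \<partial>lborel) < \<infinity>"
proof -
  \<comment> \<open>The variance for which the integrand is a multiple of the centred isotropic
    Gaussian density.\<close>
  define s where "s = 1 / (2 * c)"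
  have s: "0 < s" "2 * s = 1 / c" using c by (auto simp: s_def)
  define k where "k = sqrt ((2 * pi * s) ^ CARD('n))"
  have k: "0 < k" using s by (simp add: k_def)
  have "(\<integral>\<^sup>+x. ennreal (exp (- c * (norm (x :: real^'n))\<^sup>2)) \<partial>lborel) =
      (\<integral>\<^sup>+x. ennreal k * ennreal (gauss_density 0 (mat s) (x :: real^'n)) \<partial>lborel)"
    using k s(2) c
    by (intro nn_integral_cong)
      (simp only: gauss_density_scalar[OF s(1)] k_def[symmetric] diff_0_right s(2),
        simp add: ennreal_mult[symmetric] mult.commute)
  also have "\<dots> = ennreal k"
    by (simp add: nn_integral_cmult nn_integral_gauss_density pos_def_scalar s)
  finally show ?thesis by simp
qed

section \<open>Positivity, mass and decay of finite Gaussian mixtures\<close>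

lemma gauss_mixtures_pos:
  assumes "g \<in> gauss_mixtures"
  shows "0 < g x"
proof -
  obtain m w \<mu> S where w: "\<And>j. j < m \<Longrightarrow> 0 \<le> w j" "(\<Sum>j<m. w j) = 1"
    and S: "\<And>j. j < (m::nat) \<Longrightarrow> pos_def_matrix (S j)"
    and g: "g = (\<lambda>x. \<Sum>j<m. w j * gauss_density (\<mu> j) (S j) x)"
    using assms unfolding gauss_mixtures_def by auto
  obtain j where j: "j < m" "w j \<noteq> 0" using w(2) by (metis lessThan_iff sum.neutral zero_neq_one)
  with w(1) have "0 < w j" by (simp add: order.not_eq_order_implies_strict)
  then show ?thesis
    unfolding g using j w(1) S
    by (intro sum_pos2[of _ j]) (auto simp: zero_less_mult_iff zero_le_mult_iff gauss_density_pos less_imp_le \<open>0 < w j\<close>)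
qed

lemma borel_measurable_gauss_mixtures: "g \<in> gauss_mixtures \<Longrightarrow> g \<in> borel_measurable borel"
  unfolding gauss_mixtures_def by auto

text \<open>The index set is left general so that this serves both mixtures indexed by numbers below
  m and combinations indexed by their means.\<close>

lemma nn_integral_gauss_combination:
  assumes w: "\<And>j. j \<in> J \<Longrightarrow> 0 \<le> w j" and S: "\<And>j. j \<in> J \<Longrightarrow> pos_def_matrix (S j)"
  shows "(\<integral>\<^sup>+x. ennreal (\<Sum>j\<in>J. w j * gauss_density (\<mu> j) (S j) x) \<partial>lborel) = ennreal (\<Sum>j\<in>J. w j)"
proof -
  have "(\<integral>\<^sup>+x. ennreal (\<Sum>j\<in>J. w j * gauss_density (\<mu> j) (S j) x) \<partial>lborel) =
      (\<integral>\<^sup>+x. (\<Sum>j\<in>J. ennreal (w j) * ennreal (gauss_density (\<mu> j) (S j) x)) \<partial>lborel)"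
    using w S
    by (intro nn_integral_cong) (subst sum_ennreal[symmetric], auto simp: ennreal_mult less_imp_le[OF gauss_density_pos] intro!: sum.cong mult_nonneg_nonneg)
  also have "\<dots> = (\<Sum>j\<in>J. ennreal (w j) * (\<integral>\<^sup>+x. ennreal (gauss_density (\<mu> j) (S j) x) \<partial>lborel))"
    by (simp add: nn_integral_sum nn_integral_cmult)
  also have "\<dots> = ennreal (\<Sum>j\<in>J. w j)"
    using w S by (simp add: nn_integral_gauss_density sum_ennreal)
  finally show ?thesis .
qed

lemma nn_integral_gauss_mixtures:
  assumes "g \<in> gauss_mixtures"
  shows "(\<integral>\<^sup>+x. ennreal (g x) \<partial>lborel) = 1"
proof -
  obtain m w \<mu> S where w: "\<And>j. j < m \<Longrightarrow> 0 \<le> w j" "(\<Sum>j<m. w j) = 1"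
    and S: "\<And>j. j < (m::nat) \<Longrightarrow> pos_def_matrix (S j)"
    and g: "g = (\<lambda>x. \<Sum>j<m. w j * gauss_density (\<mu> j) (S j) x)"
    using assms unfolding gauss_mixtures_def by auto
  show ?thesis
    unfolding g using w S by (subst nn_integral_gauss_combination) auto
qed

lemma gauss_mixtures_le_exp:
  assumes "g \<in> gauss_mixtures"
  obtains K c where "0 < c" "\<And>x. g x \<le> K * exp (- c * (norm x)\<^sup>2)"
proof -
  obtain m w \<mu> S where w: "\<And>j. j < m \<Longrightarrow> 0 \<le> w j" "(\<Sum>j<m. w j) = 1"
    and S: "\<And>j. j < (m::nat) \<Longrightarrow> pos_def_matrix (S j)"
    and g: "g = (\<lambda>x. \<Sum>j<m. w j * gauss_density (\<mu> j) (S j) x)"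
    using assms unfolding gauss_mixtures_def by auto
  have "\<exists>K c. 0 < c \<and> (\<forall>x. gauss_density (\<mu> j) (S j) x \<le> K * exp (- c * (norm x)\<^sup>2))" if "j < m" for j
    by (rule gauss_density_le_exp[OF S[OF that], of "\<mu> j"]) blast
  then obtain K c where c: "\<And>j. j < m \<Longrightarrow> 0 < c j"
    and K: "\<And>j x. j < m \<Longrightarrow> gauss_density (\<mu> j) (S j) x \<le> K j * exp (- c j * (norm x)\<^sup>2)"
    by metis
  have m: "0 < m" using w(2) by (cases m) auto
  define d where "d = Min (c ` {..<m})"
  have d: "0 < d" "\<And>j. j < m \<Longrightarrow> d \<le> c j"
    unfolding d_def using m c by (subst Min_gr_iff) (auto intro!: Min_le)
  have "g x \<le> (\<Sum>j<m. w j * K j) * exp (- d * (norm x)\<^sup>2)" for x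
    unfolding g sum_distrib_right
  proof (intro sum_mono)
    fix j assume "j \<in> {..<m}"
    then have j: "j < m" by simp
    \<comment> \<open>Lowering the decay rate to the common \<open>d\<close> is legitimate only for
      a nonnegative constant; the sign is forced because the bound dominates a positive
      density.\<close>
    have "0 < K j * exp (- c j * (norm x)\<^sup>2)"
      using K[OF j, of x] gauss_density_pos[OF S[OF j], of "\<mu> j" x] by linarith
    then have "0 \<le> K j" by (simp add: zero_less_mult_iff)
    have "- c j * (norm x)\<^sup>2 \<le> - d * (norm x)\<^sup>2" using d(2)[OF j] by (simp add: mult_right_mono)
    with \<open>0 \<le> K j\<close> have "K j * exp (- c j * (norm x)\<^sup>2) \<le> K j * exp (- d * (norm x)\<^sup>2)"
      by (intro mult_left_mono) auto
    with K[OF j, of x] have "gauss_density (\<mu> j) (S j) x \<le> K j * exp (- d * (norm x)\<^sup>2)" by linarith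
    from mult_left_mono[OF this w(1)[OF j]]
    show "w j * gauss_density (\<mu> j) (S j) x \<le> w j * K j * exp (- d * (norm x)\<^sup>2)" by (simp add: mult.assoc)
  qed
  with d(1) show ?thesis by (rule that)
qed

section \<open>Positive and negative part of KL, and the second moment\<close>

text \<open>This is ln t <= t - 1 at t = b / a, the pointwise form of Gibbs' inequality.\<close>

lemma diff_le_mult_ln_div:
  fixes a b :: real
  assumes "0 \<le> a" "0 < b"
  shows "a - b \<le> a * ln (a / b)"
proof (cases "a = 0")
  case False
  with assms have a: "0 < a" by simp
  have "ln (b / a) \<le> b / a - 1" using a assms by (intro ln_le_minus_one) simp
  then have "a * ln (b / a) \<le> a * (b / a - 1)" using a by simp
  then show ?thesis using a assms by (simp add: ln_div algebra_simps)
qed (use assms in simp)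

lemma KL_eq_of_pos:
  assumes "\<And>x. 0 < g x"
  shows "KL f g = enn2ereal (\<integral>\<^sup>+x. ennreal (f x * ln (f x / g x)) \<partial>lborel)
    - enn2ereal (\<integral>\<^sup>+x. ennreal (- (f x * ln (f x / g x))) \<partial>lborel)"
proof -
  have "kl_integrand f g x = ereal (f x * ln (f x / g x))" for x
    using assms[of x] by (simp add: kl_integrand_def zero_ereal_def)
  then show ?thesis by (simp add: KL_def e2ennreal_ereal)
qed

text \<open>The first bound excludes an indeterminate difference, so that finite KL forces a finite
  positive part; the second is nonnegativity of KL. Pointwise, - f ln (f / g) <= g - f <= g gives
  the first, and integrating f - g <= f ln (f / g) with equal masses gives the second.\<close>

lemma KL_negative_part_le:
  assumes f: "is_density f" and g: "g \<in> gauss_mixtures"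
  shows "(\<integral>\<^sup>+x. ennreal (- (f x * ln (f x / g x))) \<partial>lborel) \<le> 1"
    and "(\<integral>\<^sup>+x. ennreal (- (f x * ln (f x / g x))) \<partial>lborel) \<le> (\<integral>\<^sup>+x. ennreal (f x * ln (f x / g x)) \<partial>lborel)"
proof -
  have [measurable]: "f \<in> borel_measurable borel" "g \<in> borel_measurable borel"
    using f borel_measurable_gauss_mixtures[OF g] by (auto simp: is_density_def)
  have f0: "0 \<le> f x" and f1: "(\<integral>\<^sup>+x. ennreal (f x) \<partial>lborel) = 1" for x
    using f by (auto simp: is_density_def)
  note g0 = gauss_mixtures_pos[OF g] and g1 = nn_integral_gauss_mixtures[OF g]
  have *: "f x - g x \<le> f x * ln (f x / g x)" for x
    by (rule diff_le_mult_ln_div[OF f0 g0])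
  show N: "(\<integral>\<^sup>+x. ennreal (- (f x * ln (f x / g x))) \<partial>lborel) \<le> 1"
    unfolding g1[symmetric]
  proof (intro nn_integral_mono ennreal_leI)
    fix x show "- (f x * ln (f x / g x)) \<le> g x" using *[of x] f0[of x] by linarith
  qed
  \<comment> \<open>Subtraction in \<open>ennreal\<close> truncates. Hence f is added on the left
    and g on the right; both integrate to 1 and cancel at the end.\<close>
  have "(\<integral>\<^sup>+x. ennreal (- (f x * ln (f x / g x))) \<partial>lborel) + 1 =
      (\<integral>\<^sup>+x. ennreal (- (f x * ln (f x / g x))) + ennreal (f x) \<partial>lborel)"
    by (subst nn_integral_add) (auto simp: f1)
  also have "\<dots> \<le> (\<integral>\<^sup>+x. ennreal (f x * ln (f x / g x)) + ennreal (g x) \<partial>lborel)"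
  proof (intro nn_integral_mono)
    fix x
    show "ennreal (- (f x * ln (f x / g x))) + ennreal (f x) \<le> ennreal (f x * ln (f x / g x)) + ennreal (g x)"
    proof (cases "0 \<le> f x * ln (f x / g x)")
      case True
      then show ?thesis using *[of x] f0[of x] g0[of x]
        by (simp add: ennreal_neg ennreal_plus[symmetric] del: ennreal_plus) 
    next
      case False
      then show ?thesis using *[of x] f0[of x] g0[of x]
        by (simp add: ennreal_neg ennreal_plus[symmetric] del: ennreal_plus)
    qed
  qed
  also have "\<dots> = (\<integral>\<^sup>+x. ennreal (f x * ln (f x / g x)) \<partial>lborel) + 1"
    by (subst nn_integral_add) (auto simp: g1)
  finally show "(\<integral>\<^sup>+x. ennreal (- (f x * ln (f x / g x))) \<partial>lborel) \<le> (\<integral>\<^sup>+x. ennreal (f x * ln (f x / g x)) \<partial>lborel)"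
    by (simp add: add.commute ennreal_add_left_cancel_le)
qed

lemma KL_gauss_mixture_nonneg:
  assumes "is_density f" "g \<in> gauss_mixtures"
  shows "0 \<le> KL f g"
  unfolding KL_eq_of_pos[of g, OF gauss_mixtures_pos[OF assms(2)]]
  using KL_negative_part_le(2)[OF assms] by (simp add: ereal_diff_positive less_eq_ennreal.rep_eq)

lemma second_moment_finite_if_KL_finite:
  fixes f :: "real^'n \<Rightarrow> real"
  assumes f: "is_density f" and g: "g \<in> gauss_mixtures" and fin: "KL f g < \<infinity>"
  shows "(\<integral>\<^sup>+ x. ennreal ((norm x)\<^sup>2 * f x) \<partial>lborel) < \<infinity>"
proof -
  have [measurable]: "f \<in> borel_measurable borel" "g \<in> borel_measurable borel"
    using f borel_measurable_gauss_mixtures[OF g] by (auto simp: is_density_def)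
  have f0: "0 \<le> f x" and f1: "(\<integral>\<^sup>+x. ennreal (f x) \<partial>lborel) = 1" for x
    using f by (auto simp: is_density_def)
  note g0 = gauss_mixtures_pos[OF g]
  let ?P = "\<integral>\<^sup>+x. ennreal (f x * ln (f x / g x)) \<partial>lborel"
  let ?N = "\<integral>\<^sup>+x. ennreal (- (f x * ln (f x / g x))) \<partial>lborel"
  have P: "?P < \<infinity>"
  proof (rule ccontr)
    assume "\<not> ?P < \<infinity>"
    then have P: "?P = top" by (simp add: less_top[symmetric])
    have "?N \<noteq> top" using KL_negative_part_le(1)[OF f g] by (auto simp: top_unique)
    then have "enn2ereal ?N \<noteq> \<infinity>" by (metis enn2ereal_top enn2ereal_inject)
    then have "KL f g = \<infinity>" unfolding KL_eq_of_pos[of g, OF g0] P by simp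
    with fin show False by simp
  qed
  obtain K c' where c': "0 < c'" "\<And>x. g x \<le> K * exp (- c' * (norm x)\<^sup>2)"
    using gauss_mixtures_le_exp[OF g] by metis
  \<comment> \<open>Half of the decay of g is spent on the comparison of f with exp (- c |x|^2),
    which costs c |x|^2 f. The other half is the term that gets bounded.\<close>
  define c where "c = c' / 2"
  have c: "0 < c" and K: "\<And>x. g x \<le> K * exp (- (2 * c) * (norm x)\<^sup>2)"
    using c' by (simp_all add: c_def)
  have "0 < K * exp 0" using g0[of 0] K[of 0] by simp
  then have K0: "0 < K" by simp
  have le: "c * ((norm x)\<^sup>2 * f x) \<le> max 0 (f x * ln (f x / g x)) + exp (- c * (norm x)\<^sup>2) + \<bar>ln K\<bar> * f x" for x
  proof (cases "f x = 0")
    case False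
    then have fx: "0 < f x" using f0[of x] by simp
    have "ln (g x) \<le> ln (K * exp (- (2 * c) * (norm x)\<^sup>2))" using K g0 by (intro ln_mono) auto
    also have "\<dots> = ln K - 2 * c * (norm x)\<^sup>2" using K0 by (simp add: ln_mult)
    finally have "f x * ln (g x) \<le> f x * (ln K - 2 * c * (norm x)\<^sup>2)" using fx by simp
    then have "f x * ln (g x) \<le> f x * ln K - 2 * (c * ((norm x)\<^sup>2 * f x))" by (simp add: algebra_simps)
    moreover have "f x - exp (- c * (norm x)\<^sup>2) \<le> f x * ln (f x / exp (- c * (norm x)\<^sup>2))"
      by (rule diff_le_mult_ln_div[OF f0]) simp
    moreover have "f x * ln (f x / exp (- c * (norm x)\<^sup>2)) = f x * ln (f x) + c * ((norm x)\<^sup>2 * f x)"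
      using fx by (simp add: ln_div algebra_simps)
    moreover have "f x * ln (f x / g x) = f x * ln (f x) - f x * ln (g x)"
      using fx g0[of x] by (simp add: ln_div algebra_simps)
    moreover have "f x * ln K \<le> \<bar>ln K\<bar> * f x" using fx by (simp add: mult.commute)
    moreover have "f x * ln (f x / g x) \<le> max 0 (f x * ln (f x / g x))" by simp
    ultimately show ?thesis using fx by linarith
  qed simp
  have "ennreal c * (\<integral>\<^sup>+ x. ennreal ((norm x)\<^sup>2 * f x) \<partial>lborel) = (\<integral>\<^sup>+ x. ennreal (c * ((norm x)\<^sup>2 * f x)) \<partial>lborel)"
    using c f0 by (simp add: nn_integral_cmult[symmetric] ennreal_mult)
  also have "\<dots> \<le> (\<integral>\<^sup>+ x. ennreal (f x * ln (f x / g x)) + ennreal (exp (- c * (norm x)\<^sup>2)) + ennreal \<bar>ln K\<bar> * ennreal (f x) \<partial>lborel)"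
  proof (intro nn_integral_mono)
    fix x
    have "ennreal (c * ((norm x)\<^sup>2 * f x)) \<le> ennreal (max 0 (f x * ln (f x / g x)) + exp (- c * (norm x)\<^sup>2) + \<bar>ln K\<bar> * f x)"
      by (rule ennreal_leI[OF le])
    also have "\<dots> = ennreal (f x * ln (f x / g x)) + ennreal (exp (- c * (norm x)\<^sup>2)) + ennreal \<bar>ln K\<bar> * ennreal (f x)"
      using f0[of x] by (simp add: ennreal_plus ennreal_mult max_def ennreal_neg)
    finally show "ennreal (c * ((norm x)\<^sup>2 * f x)) \<le> \<dots>" .
  qed
  also have "\<dots> = ?P + (\<integral>\<^sup>+ x. ennreal (exp (- c * (norm (x::real^'n))\<^sup>2)) \<partial>lborel) + ennreal \<bar>ln K\<bar>"
    by (simp add: nn_integral_add nn_integral_cmult f1)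
  also have "\<dots> < \<infinity>" using P nn_integral_exp_neg_norm_square[OF c, where 'n='n] by simp
  finally show ?thesis using c by (auto simp: ennreal_mult_less_top)
qed

section \<open>Integrability of f log_+ f for densities in \<open>F_CSSA\<close>\<close>

lemma log_plus_le_Dlog:
  fixes g :: "real^'n \<Rightarrow> real"
  assumes [measurable]: "g \<in> borel_measurable borel" and g0: "\<And>x. 0 \<le> g x"
    and g1: "(\<integral>\<^sup>+x. ennreal (g x) \<partial>lborel) \<le> 1"
    and r: "0 < r" and C: "closed_cube r (C y)" and y: "y \<in> C y"
  shows "ennreal (log_plus (g y)) \<le> Dlog g C y + ennreal (CARD('n) * log_plus (1 / r))"
\<comment> \<open>With a vanishing infimum \<open>Dlog\<close> is infinite and the claim is trivial.
  Otherwise the infimum is positive and its logarithm can be bounded through the mass over the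
  cube.\<close>
proof (cases "Inf (g ` C y) \<le> 0")
  case True
  then show ?thesis by (simp add: Dlog_def)
next
  case False
  define I where "I = Inf (g ` C y)"
  have I0: "0 < I" using False by (simp add: I_def)
  have I: "I \<le> g z" if "z \<in> C y" for z
    unfolding I_def using that g0 by (intro cInf_lower bdd_belowI[of _ 0]) auto
  obtain a where a: "C y = cbox a (a + r *\<^sub>R One)" using C by (auto simp: closed_cube_def)
  have "emeasure lborel (C y) = (\<Prod>b\<in>(Basis :: (real^'n) set). (r *\<^sub>R One) \<bullet> b)"
    unfolding a using r by (subst emeasure_lborel_cbox) (simp_all add: inner_add_left)
  also have "\<dots> = ennreal (r ^ CARD('n))" by simp
  finally have vol: "emeasure lborel (C y) = ennreal (r ^ CARD('n))" .
  have [measurable]: "C y \<in> sets borel" by (simp add: a)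
  have "ennreal (I * r ^ CARD('n)) = (\<integral>\<^sup>+x. ennreal I * indicator (C y) x \<partial>lborel)"
    using I0 r by (simp add: nn_integral_cmult vol ennreal_mult)
  also have "\<dots> \<le> (\<integral>\<^sup>+x. ennreal (g x) \<partial>lborel)"
    using I by (intro nn_integral_mono) (auto simp: indicator_def ennreal_leI)
  also have "\<dots> \<le> ennreal 1" using g1 by simp
  finally have "I * r ^ CARD('n) \<le> 1" by (simp add: ennreal_le_iff)
  then have "ln (I * r ^ CARD('n)) \<le> ln 1" using I0 r by (intro ln_mono) auto
  then have lnI: "ln I \<le> CARD('n) * ln (1 / r)"
    using I0 r by (simp add: ln_mult ln_realpow ln_div)
  have "CARD('n) * ln (1 / r) \<le> CARD('n) * log_plus (1 / r)"
    by (intro mult_left_mono) (auto simp: log_plus_def)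
  moreover have gy: "0 < g y" "0 \<le> ln (g y / I)" using I[OF y] I0 by auto
  moreover have "ln (g y) = ln (g y / I) + ln I" using gy I0 by (simp add: ln_div)
  moreover have lp: "0 \<le> CARD('n) * log_plus (1 / r)" by (simp add: log_plus_def)
  ultimately have "log_plus (g y) \<le> ln (g y / I) + CARD('n) * log_plus (1 / r)"
    using lnI unfolding log_plus_def[of "g y"] by linarith
  then have "ennreal (log_plus (g y)) \<le> ennreal (ln (g y / I)) + ennreal (CARD('n) * log_plus (1 / r))"
    using gy lp by (simp add: ennreal_plus[symmetric] ennreal_leI del: ennreal_plus)
  then show ?thesis using I0 by (simp add: Dlog_def I_def)
qed

lemma F_CSSA_log_plus_integrable:
  fixes f :: "real^'n \<Rightarrow> real"
  assumes "f \<in> F_CSSA"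
  shows "(\<integral>\<^sup>+ x. ennreal (f x * log_plus (f x)) \<partial>lborel) < \<infinity>"
proof -
  define F where "F = density lborel (\<lambda>x. ennreal (f x))"
  obtain Y :: "nat \<Rightarrow> (real^'n) set" and r C A h
    where dens: "is_density f"
    and Ys: "\<forall>l. Y l \<in> sets lborel" and Y: "disjoint_family Y" "(\<Union>l. Y l) = supp f"
    and wit: "\<forall>l. measure F (Y l) > 0 \<longrightarrow>
        FSSA_witness (\<lambda>x. f x * indicator (Y l) x / measure F (Y l)) (r l) (C l) (A l) (h l)"
    and D: "(\<Sum>l. if measure F (Y l) > 0 then ennreal (measure F (Y l)) *
        (\<integral>\<^sup>+ y. ennreal (f y * indicator (Y l) y / measure F (Y l)) *
          Dlog (\<lambda>x. f x * indicator (Y l) x / measure F (Y l)) (C l) y *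
          indicator (supp (\<lambda>x. f x * indicator (Y l) x / measure F (Y l))) y \<partial>lborel) else 0) < \<infinity>"
    and R: "summable (\<lambda>l. if measure F (Y l) > 0 then measure F (Y l) * log_plus (1 / r l) else 0)"
    using assms[unfolded F_CSSA_def Let_def mem_Collect_eq, folded F_def]
    by (elim conjE exE) (rule that; assumption)
  have [measurable]: "f \<in> borel_measurable borel" and f0: "\<And>x. 0 \<le> f x"
    and f1: "(\<integral>\<^sup>+x. ennreal (f x) \<partial>lborel) = 1"
    using dens by (auto simp: is_density_def)
  have [measurable]: "Y l \<in> sets borel" for l using Ys by simp
  interpret F: prob_space F
    by (rule prob_spaceI) (simp add: F_def emeasure_density f1)
  define p where "p l = measure F (Y l)" for l
  have p: "0 \<le> p l" "p l \<le> 1" for l by (auto simp: p_def)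
  have pI: "(\<integral>\<^sup>+x. ennreal (f x) * indicator (Y l) x \<partial>lborel) = ennreal (p l)" for l
  proof -
    have "ennreal (p l) = emeasure F (Y l)" by (simp add: p_def F.emeasure_eq_measure)
    then show ?thesis by (simp add: F_def emeasure_density)
  qed
  have fY: "0 < f x" if "x \<in> Y l" for x l
    using that Y(2) by (auto simp: supp_def)
  define fl where "fl l = (\<lambda>x. f x * indicator (Y l) x / p l)" for l
  define E where "E l = (\<integral>\<^sup>+ y. ennreal (fl l y) * Dlog (fl l) (C l) y * indicator (supp (fl l)) y \<partial>lborel)" for l
  define a where "a l = (if p l > 0 then ennreal (p l) * E l else 0)" for l
  define b where "b l = (if p l > 0 then p l * log_plus (1 / r l) else 0)" for l
  have a: "(\<Sum>l. a l) < \<infinity>" using D unfolding a_def E_def fl_def p_def .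
  have b: "summable b" using R unfolding b_def p_def .
  have b0: "0 \<le> b l" for l by (auto simp: b_def log_plus_def)
  have main: "(\<integral>\<^sup>+x. ennreal (f x * log_plus (f x)) * indicator (Y l) x \<partial>lborel)
      \<le> a l + ennreal (CARD('n) * b l)" for l
  proof (cases "p l > 0")
    case False
    \<comment> \<open>No witness is available for a piece of mass zero. But f is positive on all of
      \<open>Y l\<close>, so such a piece is a Lebesgue null set and contributes nothing.\<close>
    then have "p l = 0" using p(1)[of l] by simp
    then have "AE x in lborel. ennreal (f x) * indicator (Y l) x = 0"
      using pI[of l] by (simp add: nn_integral_0_iff_AE)
    then have "AE x in lborel. ennreal (f x * log_plus (f x)) * indicator (Y l) x = 0"
    proof eventually_elim
      case (elim x)
      then show ?case using fY[of x l] by (cases "x \<in> Y l") (auto simp: ennreal_eq_0_iff)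
    qed
    then have "(\<integral>\<^sup>+x. ennreal (f x * log_plus (f x)) * indicator (Y l) x \<partial>lborel) = 0"
      by (subst nn_integral_0_iff_AE) (auto simp: log_plus_def)
    then show ?thesis by simp
  next
    case True
    have [measurable]: "fl l \<in> borel_measurable borel" by (simp add: fl_def)
    have fl0: "0 \<le> fl l x" for x using f0 p by (simp add: fl_def)
    have fl1: "(\<integral>\<^sup>+x. ennreal (fl l x) \<partial>lborel) = 1"
    proof -
      have "(\<integral>\<^sup>+x. ennreal (fl l x) \<partial>lborel) = (\<integral>\<^sup>+x. ennreal (1 / p l) * (ennreal (f x) * indicator (Y l) x) \<partial>lborel)"
        using True f0 by (intro nn_integral_cong)
          (auto simp: fl_def indicator_def ennreal_mult[symmetric])
      also have "\<dots> = ennreal (1 / p l) * ennreal (p l)" by (simp add: nn_integral_cmult pI)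
      also have "\<dots> = 1" using True by (simp add: ennreal_mult[symmetric])
      finally show ?thesis .
    qed
    have supp: "supp (fl l) = Y l"
      using True fY by (auto simp: supp_def fl_def indicator_def)
    have "FSSA_witness (fl l) (r l) (C l) (A l) (h l)"
      using spec[OF wit, of l] True by (simp add: fl_def p_def)
    then have r: "0 < r l" and C: "\<And>y. y \<in> Y l \<Longrightarrow> closed_cube (r l) (C l y) \<and> y \<in> C l y"
      and mD: "(\<lambda>y. Dlog (fl l) (C l) y * indicator (Y l) y) \<in> borel_measurable borel"
      by (auto simp: FSSA_witness_def supp)
    \<comment> \<open>The witness gives measurability of \<open>Dlog\<close> only after
      multiplication by the indicator of the support, so this product is what gets
      integrated.\<close>
    define G where "G = (\<lambda>y. Dlog (fl l) (C l) y * indicator (Y l) y)"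
    have [measurable]: "G \<in> borel_measurable borel" using mD by (simp add: G_def)
    define k where "k = CARD('n) * log_plus (1 / r l)"
    have k: "0 \<le> k" by (simp add: k_def log_plus_def)
    have pw: "ennreal (f x * log_plus (f x)) * indicator (Y l) x
        \<le> ennreal (p l) * (ennreal (fl l x) * G x + ennreal k * ennreal (fl l x))" for x
    proof (cases "x \<in> Y l")
      case x: True
      have fx: "f x = p l * fl l x" using True x by (simp add: fl_def)
      \<comment> \<open>Normalising divides by a mass of at most 1 and so only increases the
        function. For an upper bound on log_+ f no term in log p_l arises.\<close>
      have "f x \<le> fl l x" unfolding fx using p[of l] fl0[of x] by (simp add: mult_left_le_one_le)
      then have "log_plus (f x) \<le> log_plus (fl l x)"
        using fY[OF x] unfolding log_plus_def by (intro max.mono ln_mono order_refl) auto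
      then have "ennreal (log_plus (f x)) \<le> ennreal (log_plus (fl l x))" by (rule ennreal_leI)
      also have "\<dots> \<le> Dlog (fl l) (C l) x + ennreal k"
        unfolding k_def using C[OF x] r by (intro log_plus_le_Dlog) (auto simp: fl0 fl1)
      finally have "ennreal (f x) * ennreal (log_plus (f x)) \<le> ennreal (f x) * (Dlog (fl l) (C l) x + ennreal k)"
        by (rule mult_left_mono) simp
      then show ?thesis
        using x fl0[of x] p(1)[of l] f0[of x]
        by (simp add: G_def ennreal_mult log_plus_def) (simp add: fx ennreal_mult algebra_simps)
    qed simp
    have "(\<integral>\<^sup>+x. ennreal (f x * log_plus (f x)) * indicator (Y l) x \<partial>lborel)
        \<le> (\<integral>\<^sup>+x. ennreal (p l) * (ennreal (fl l x) * G x + ennreal k * ennreal (fl l x)) \<partial>lborel)"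
      by (intro nn_integral_mono pw)
    also have "\<dots> = ennreal (p l) * ((\<integral>\<^sup>+x. ennreal (fl l x) * G x \<partial>lborel) + ennreal k)"
      by (simp add: nn_integral_cmult nn_integral_add fl1)
    also have "(\<integral>\<^sup>+x. ennreal (fl l x) * G x \<partial>lborel) = E l"
      by (simp add: E_def G_def supp mult.assoc)
    also have "ennreal (p l) * (E l + ennreal k) = a l + ennreal (CARD('n) * b l)"
      using True k by (simp add: a_def b_def k_def distrib_left ennreal_mult[symmetric] ac_simps)
    finally show ?thesis .
  qed
  have "(\<integral>\<^sup>+ x. ennreal (f x * log_plus (f x)) \<partial>lborel)
      = (\<integral>\<^sup>+ x. (\<Sum>l. ennreal (f x * log_plus (f x)) * indicator (Y l) x) \<partial>lborel)"
  proof (intro nn_integral_cong)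
    fix x
    have "(\<Sum>l. ennreal (f x * log_plus (f x)) * indicator (Y l) x)
        = ennreal (f x * log_plus (f x)) * indicator (\<Union>l. Y l) x"
      by (simp add: suminf_indicator[OF Y(1)])
    also have "\<dots> = ennreal (f x * log_plus (f x))"
      unfolding Y(2) using f0[of x] by (auto simp: supp_def indicator_def)
    finally show "ennreal (f x * log_plus (f x)) = (\<Sum>l. ennreal (f x * log_plus (f x)) * indicator (Y l) x)" by simp
  qed
  also have "\<dots> = (\<Sum>l. \<integral>\<^sup>+ x. ennreal (f x * log_plus (f x)) * indicator (Y l) x \<partial>lborel)"
    by (rule nn_integral_suminf) (simp add: log_plus_def)
  also have "\<dots> \<le> (\<Sum>l. a l + ennreal (CARD('n) * b l))"
    by (intro suminf_le main) auto
  also have "\<dots> = (\<Sum>l. a l) + (\<Sum>l. ennreal (CARD('n) * b l))"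
    by (subst suminf_add) auto
  also have "(\<Sum>l. ennreal (CARD('n) * b l)) = ennreal (\<Sum>l. CARD('n) * b l)"
    using b b0 by (intro suminf_ennreal_eq summable_sums summable_mult) auto
  also have "(\<Sum>l. a l) + ennreal (\<Sum>l. CARD('n) * b l) < \<infinity>" using a by simp
  finally show ?thesis .
qed

section \<open>Gaussian mixtures converging almost everywhere to a given density\<close>

text \<open>The weights are not normalised, because L1 approximation only brings the total mass
  close to 1; normalisation is postponed to the last step. The means themselves serve as indices,
  which suits sums over the range of a simple function.\<close>

definition iso_gauss_combinations :: "(real^'n \<Rightarrow> real) set" where
  "iso_gauss_combinations = {g. \<exists>J w s. finite J \<and> (\<forall>v\<in>J. 0 \<le> w v) \<and> 0 < s
     \<and> g = (\<lambda>x. \<Sum>v\<in>J. w v * gauss_density v (mat s) x)}"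

lemma gauss_mixtures_finite_set:
  assumes J: "finite J" and w: "\<And>v. v \<in> J \<Longrightarrow> 0 \<le> w v" "(\<Sum>v\<in>J. w v) = 1"
    and S: "\<And>v. v \<in> J \<Longrightarrow> pos_def_matrix (S v)"
  shows "(\<lambda>x. \<Sum>v\<in>J. w v * gauss_density (\<mu> v) (S v) x) \<in> gauss_mixtures"
proof -
  obtain e where e: "bij_betw e {..<card J} J"
    using ex_bij_betw_nat_finite[OF J] by (auto simp: atLeast0LessThan)
  have "(\<Sum>v\<in>J. F v) = (\<Sum>j<card J. F (e j))" for F :: "_ \<Rightarrow> real"
    using e by (rule sum.reindex_bij_betw[symmetric])
  moreover have "e j \<in> J" if "j < card J" for j using e that by (auto simp: bij_betw_def)
  ultimately show ?thesis
    unfolding gauss_mixtures_def using w S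
    by (intro CollectI exI[of _ "card J"] exI[of _ "\<lambda>j. w (e j)"] exI[of _ "\<lambda>j. \<mu> (e j)"]
        exI[of _ "\<lambda>j. S (e j)"]) simp
qed

lemma iso_gauss_combinations_scale:
  assumes g: "g \<in> iso_gauss_combinations" and W: "(\<integral>\<^sup>+x. ennreal (g x) \<partial>lborel) = ennreal W" "0 < W"
  shows "(\<lambda>x. g x / W) \<in> gauss_mixtures"
proof -
  obtain J w s where J: "finite J" "\<And>v. v \<in> J \<Longrightarrow> 0 \<le> w v" "0 < s"
    and g: "g = (\<lambda>x. \<Sum>v\<in>J. w v * gauss_density v (mat s) x)"
    using assms unfolding iso_gauss_combinations_def by auto
  have "ennreal W = ennreal (\<Sum>v\<in>J. w v)"
    unfolding W(1)[symmetric] g using J by (intro nn_integral_gauss_combination pos_def_scalar)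
  then have "W = (\<Sum>v\<in>J. w v)" using W J by (simp add: sum_nonneg)
  then have "(\<lambda>x. \<Sum>v\<in>J. w v / W * gauss_density v (mat s) x) \<in> gauss_mixtures"
    using J W by (intro gauss_mixtures_finite_set pos_def_scalar) (auto simp: sum_divide_distrib[symmetric])
  then show ?thesis by (simp add: g sum_divide_distrib)
qed

lemma iso_gauss_combinations_nonneg: "g \<in> iso_gauss_combinations \<Longrightarrow> 0 \<le> g x"
  unfolding iso_gauss_combinations_def
  by (auto intro!: sum_nonneg mult_nonneg_nonneg less_imp_le[OF gauss_density_pos] pos_def_scalar)

lemma borel_measurable_iso_gauss_combinations:
  "g \<in> iso_gauss_combinations \<Longrightarrow> g \<in> borel_measurable borel"
  unfolding iso_gauss_combinations_def by auto

text \<open>For \<open>Y = id\<close> this is the convolution of \<open>u\<close> with a Gaussian kernel; for a simple function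
  \<open>Y\<close> it is a finite Gaussian combination of the same total mass.\<close>

definition smear :: "(real^'n \<Rightarrow> real) \<Rightarrow> real \<Rightarrow> (real^'n \<Rightarrow> real^'n) \<Rightarrow> real^'n \<Rightarrow> real" where
  "smear u s Y x = (\<integral>y. u y * gauss_density (Y y) (mat s) x \<partial>lborel)"

context
  fixes u :: "real^'n \<Rightarrow> real" and s :: real
  assumes u: "integrable lborel u" "\<And>x. 0 \<le> u x" and s: "0 < s"
begin

lemma kernel_nonneg: "0 \<le> gauss_density \<mu> (mat s) (x :: real^'n)"
  by (intro less_imp_le gauss_density_pos pos_def_scalar s)

text \<open>The peak value bounds the kernel uniformly in the mean, so a constant multiple of
  \<open>u\<close> dominates the integrand of \<open>smear\<close> for every choice of
  centres.\<close>

lemma kernel_le: "gauss_density \<mu> (mat s) (x :: real^'n) \<le> 1 / sqrt ((2 * pi * s) ^ CARD('n))"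
  using s by (simp add: gauss_density_scalar divide_right_mono)

lemma smear_measurable_kernel:
  assumes [measurable]: "(Y :: real^'n \<Rightarrow> real^'n) \<in> borel_measurable borel"
  shows "(\<lambda>(x, y). u y * gauss_density (Y y) (mat s) x) \<in> borel_measurable (lborel \<Otimes>\<^sub>M lborel)"
proof -
  have [measurable]: "u \<in> borel_measurable borel" using u(1) by auto
  show ?thesis unfolding gauss_density_scalar[OF s] split_beta by measurable
qed

lemma integrable_smear_kernel:
  assumes [measurable]: "(Y :: real^'n \<Rightarrow> real^'n) \<in> borel_measurable borel"
  shows "integrable lborel (\<lambda>y. u y * gauss_density (Y y) (mat s) x)"
proof (rule Bochner_Integration.integrable_bound)
  show "integrable lborel (\<lambda>y. u y * (1 / sqrt ((2 * pi * s) ^ CARD('n))))"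
    using u(1) by simp
  have [measurable]: "u \<in> borel_measurable borel" using u(1) by auto
  show "(\<lambda>y. u y * gauss_density (Y y) (mat s) x) \<in> borel_measurable lborel"
    unfolding gauss_density_scalar[OF s] by measurable
  show "AE y in lborel. norm (u y * gauss_density (Y y) (mat s) x) \<le> norm (u y * (1 / sqrt ((2 * pi * s) ^ CARD('n))))"
    using u(2) s kernel_le kernel_nonneg
    by (intro AE_I2) (simp add: abs_mult abs_of_nonneg mult_left_mono del: times_divide_eq_right)
qed

lemma smear_nonneg: "0 \<le> smear u s Y x"
  unfolding smear_def using u(2) kernel_nonneg
  by (intro integral_nonneg_AE) simp

lemma borel_measurable_smear:
  assumes "(Y :: real^'n \<Rightarrow> real^'n) \<in> borel_measurable borel"
  shows "smear u s Y \<in> borel_measurable borel"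
  using lborel.borel_measurable_lebesgue_integral[OF smear_measurable_kernel[OF assms]]
  by (simp add: smear_def[abs_def] split_beta)

text \<open>Tonelli: for fixed y the kernel has mass one in x, wherever its centre is. That the mass
  does not depend on \<open>Y\<close> is the hypothesis Scheffe's lemma asks for.\<close>

lemma nn_integral_smear:
  assumes Y: "(Y :: real^'n \<Rightarrow> real^'n) \<in> borel_measurable borel"
  shows "(\<integral>\<^sup>+x. ennreal (smear u s Y x) \<partial>lborel) = (\<integral>\<^sup>+x. ennreal (u x) \<partial>lborel)"
proof -
  have [measurable]: "u \<in> borel_measurable borel" using u(1) by auto
  have m: "(\<lambda>(x, y). ennreal (u y * gauss_density (Y y) (mat s) x)) \<in> borel_measurable (lborel \<Otimes>\<^sub>M lborel)"
    using measurable_compose[OF smear_measurable_kernel[OF Y] measurable_ennreal] by (simp add: split_beta)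
  have "(\<integral>\<^sup>+x. ennreal (smear u s Y x) \<partial>lborel) =
      (\<integral>\<^sup>+x. (\<integral>\<^sup>+y. ennreal (u y * gauss_density (Y y) (mat s) x) \<partial>lborel) \<partial>lborel)"
    using u(2) kernel_nonneg unfolding smear_def
    by (intro nn_integral_cong nn_integral_eq_integral[symmetric] integrable_smear_kernel Y) auto
  also have "\<dots> = (\<integral>\<^sup>+y. (\<integral>\<^sup>+x. ennreal (u y * gauss_density (Y y) (mat s) x) \<partial>lborel) \<partial>lborel)"
    using lborel_pair.Fubini'[OF m] by simp
  also have "\<dots> = (\<integral>\<^sup>+y. ennreal (u y) \<partial>lborel)"
    using u(2) kernel_nonneg by (intro nn_integral_cong)
      (simp add: ennreal_mult nn_integral_cmult nn_integral_gauss_density[OF pos_def_scalar[OF s]])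
  finally show ?thesis .
qed

lemma integrable_smear:
  assumes "(Y :: real^'n \<Rightarrow> real^'n) \<in> borel_measurable borel"
  shows "integrable lborel (smear u s Y)"
proof (rule integrableI_nonneg)
  show "(\<integral>\<^sup>+ x. ennreal (smear u s Y x) \<partial>lborel) < \<infinity>"
    using u by (simp add: nn_integral_smear assms nn_integral_eq_integral)
qed (use borel_measurable_smear[OF assms] smear_nonneg in auto)

text \<open>The weight of the Gaussian centred at v is the integral of \<open>u\<close> over the
  level set of \<open>Y\<close> at v.\<close>

lemma smear_simple_in_iso_gauss_combinations:
  assumes Y: "simple_function lborel Y"
  shows "smear u s Y \<in> iso_gauss_combinations"
proof -
  have [measurable]: "u \<in> borel_measurable borel" using u(1) by auto
  have fin: "finite (range Y)" using simple_functionD(1)[OF Y] by simp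
  have [measurable]: "Y -` {v} \<in> sets borel" for v using simple_functionD(2)[OF Y, of "{v}"] by simp
  have int: "integrable lborel (\<lambda>y. u y * indicator (Y -` {v}) y)" for v
    by (rule integrable_real_mult_indicator) (use u in auto)
  have "smear u s Y x = (\<Sum>v\<in>range Y. (\<integral>y. u y * indicator (Y -` {v}) y \<partial>lborel) * gauss_density v (mat s) x)" for x
  proof -
    have "u y * gauss_density (Y y) (mat s) x =
        (\<Sum>v\<in>range Y. u y * indicator (Y -` {v}) y * gauss_density v (mat s) x)" for y
    proof -
      have "(\<Sum>v\<in>range Y. u y * indicator (Y -` {v}) y * gauss_density v (mat s) x) =
          (\<Sum>v\<in>range Y. if v = Y y then u y * gauss_density v (mat s) x else 0)"
        by (intro sum.cong) auto
      then show ?thesis using fin by simp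
    qed
    then show ?thesis
      unfolding smear_def by (simp add: int)
  qed
  then show ?thesis
    unfolding iso_gauss_combinations_def using fin s u(2)
    by (intro CollectI exI[of _ "range Y"] exI[of _ "\<lambda>v. \<integral>y. u y * indicator (Y -` {v}) y \<partial>lborel"] exI[of _ s])
      (auto intro!: integral_nonneg_AE)
qed

text \<open>Simple functions converging to the identity quantise the centres, in place of Riemann
  sums for the convolution. The smears then converge pointwise by dominated convergence, and in L1
  because all masses agree.\<close>

lemma smear_L1_approx:
  assumes e: "0 < e"
  obtains g where "g \<in> iso_gauss_combinations"
    "(\<integral>\<^sup>+x. ennreal \<bar>g x - smear u s (\<lambda>y. y) x\<bar> \<partial>lborel) < e"
proof -
  have [measurable]: "u \<in> borel_measurable borel" using u(1) by auto
  obtain Y :: "nat \<Rightarrow> real^'n \<Rightarrow> real^'n" where Y: "\<And>i. simple_function lborel (Y i)"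
    "\<And>x. (\<lambda>i. Y i x) \<longlonglongrightarrow> x"
    using borel_measurable_implies_sequence_metric[of "\<lambda>x. x" lborel 0] by auto
  have mY[measurable]: "Y i \<in> borel_measurable borel" for i
    using borel_measurable_simple_function[OF Y(1)] by simp
  have lim: "(\<lambda>i. smear u s (Y i) x) \<longlonglongrightarrow> smear u s (\<lambda>y. y) x" for x
    unfolding smear_def
  proof (rule integral_dominated_convergence)
    show "integrable lborel (\<lambda>y. u y * (1 / sqrt ((2 * pi * s) ^ CARD('n))))"
      using u(1) by simp
    show "AE y in lborel. norm (u y * gauss_density (Y i y) (mat s) x) \<le> u y * (1 / sqrt ((2 * pi * s) ^ CARD('n)))" for i
      using u(2) s kernel_le kernel_nonneg
      by (intro AE_I2) (simp add: abs_mult abs_of_nonneg mult_left_mono del: times_divide_eq_right)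
    have c: "continuous_on UNIV (\<lambda>v. gauss_density v (mat s) x)" by (intro continuous_intros)
    show "AE y in lborel. (\<lambda>i. u y * gauss_density (Y i y) (mat s) x) \<longlonglongrightarrow> u y * gauss_density y (mat s) x"
      by (intro AE_I2 tendsto_mult tendsto_const continuous_on_tendsto_compose[OF c] Y(2)) auto
  qed (use integrable_smear_kernel[OF mY, THEN borel_measurable_integrable]
      integrable_smear_kernel[of "\<lambda>y. y", THEN borel_measurable_integrable] in auto)
  have "(\<lambda>i. \<integral>\<^sup>+x. norm (smear u s (Y i) x - smear u s (\<lambda>y. y) x) \<partial>lborel) \<longlonglongrightarrow> 0"
  proof (rule Scheffe_lemma2)
    show "(\<integral>\<^sup>+x. norm (smear u s (Y i) x) \<partial>lborel) \<le> (\<integral>\<^sup>+x. norm (smear u s (\<lambda>y. y) x) \<partial>lborel)" for i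
      by (simp add: smear_nonneg nn_integral_smear)
  qed (use lim integrable_smear borel_measurable_smear in auto)
  from order_tendstoD(2)[OF this, of e] e
  obtain i where "(\<integral>\<^sup>+x. norm (smear u s (Y i) x - smear u s (\<lambda>y. y) x) \<partial>lborel) < e"
    by (auto simp: eventually_sequentially)
  with that[OF smear_simple_in_iso_gauss_combinations[OF Y(1)]] show ?thesis by simp
qed

text \<open>Substituting y = x + sqrt s z moves the dependence on \<open>s\<close> from the kernel
  into the argument of \<open>u\<close>, so that letting \<open>s\<close> tend to 0 happens under
  one fixed Gaussian.\<close>

lemma smear_substitution:
  "smear u s (\<lambda>y. y) x = (\<integral>z. u (x + sqrt s *\<^sub>R z) * gauss_density 0 (mat 1) z \<partial>lborel)"
proof -
  have [measurable]: "u \<in> borel_measurable borel" using u(1) by auto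
  define c where "c = sqrt s"
  have c: "0 < c" "c\<^sup>2 = s" using s by (auto simp: c_def)
  \<comment> \<open>The Jacobian of the substitution cancels the power of \<open>s\<close> in the
    normalising constant.\<close>
  have k: "c ^ CARD('n) * gauss_density (x + c *\<^sub>R z) (mat s) x = gauss_density 0 (mat 1) z" for z :: "real^'n"
  proof -
    have "sqrt ((2 * pi * s) ^ CARD('n)) = c ^ CARD('n) * sqrt ((2 * pi) ^ CARD('n))"
      using c by (simp add: c_def power_mult_distrib real_sqrt_mult real_sqrt_power)
    moreover have "(norm (x - (x + c *\<^sub>R z)))\<^sup>2 / (2 * s) = (norm z)\<^sup>2 / 2"
      using c s by (simp add: power_mult_distrib)
    ultimately show ?thesis using c
      by (simp add: gauss_density_scalar[OF s] gauss_density_scalar)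
  qed
  let ?h = "\<lambda>y. u y * gauss_density y (mat s) x"
  have [measurable]: "?h \<in> borel_measurable borel"
    unfolding gauss_density_scalar[OF s] by measurable
  have "smear u s (\<lambda>y. y) x = (\<integral>y. ?h y \<partial>density (distr lborel borel (\<lambda>z. x + c *\<^sub>R z)) (\<lambda>_. ennreal (\<bar>c\<bar> ^ DIM(real^'n))))"
    unfolding smear_def using c by (subst (1) lborel_affine[of c x]) (auto simp: ennreal_power)
  also have "\<dots> = (\<integral>z. c ^ CARD('n) * ?h (x + c *\<^sub>R z) \<partial>lborel)"
    using c by (subst integral_density) (auto simp: integral_distr)
  also have "\<dots> = (\<integral>z. u (x + c *\<^sub>R z) * gauss_density 0 (mat 1) z \<partial>lborel)"
    by (intro Bochner_Integration.integral_cong) (auto simp: k[symmetric])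
  finally show ?thesis by (simp add: c_def)
qed

end

lemma integrable_std_gauss: "integrable lborel (gauss_density 0 (mat 1) :: real^'n \<Rightarrow> real)"
  and integral_std_gauss: "(\<integral>z. gauss_density 0 (mat 1) (z :: real^'n) \<partial>lborel) = 1"
proof -
  have p: "pos_def_matrix (mat 1 :: real^'n^'n)" by (rule pos_def_scalar) simp
  have "has_bochner_integral lborel (gauss_density 0 (mat 1) :: real^'n \<Rightarrow> real) 1"
    by (rule has_bochner_integral_nn_integral)
      (auto simp: nn_integral_gauss_density[OF p] less_imp_le[OF gauss_density_pos[OF p]])
  then show "integrable lborel (gauss_density 0 (mat 1) :: real^'n \<Rightarrow> real)"
    "(\<integral>z. gauss_density 0 (mat 1) (z :: real^'n) \<partial>lborel) = 1"
    by (auto simp: has_bochner_integral_iff)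
qed

lemma L1_triangle:
  fixes f g h :: "'a \<Rightarrow> real"
  assumes [measurable]: "f \<in> borel_measurable M" "g \<in> borel_measurable M" "h \<in> borel_measurable M"
  shows "(\<integral>\<^sup>+x. ennreal \<bar>f x - h x\<bar> \<partial>M) \<le> (\<integral>\<^sup>+x. ennreal \<bar>f x - g x\<bar> \<partial>M) + (\<integral>\<^sup>+x. ennreal \<bar>g x - h x\<bar> \<partial>M)"
proof -
  have "(\<integral>\<^sup>+x. ennreal \<bar>f x - h x\<bar> \<partial>M) \<le> (\<integral>\<^sup>+x. ennreal \<bar>f x - g x\<bar> + ennreal \<bar>g x - h x\<bar> \<partial>M)"
    by (intro nn_integral_mono) (simp add: ennreal_plus[symmetric] ennreal_leI del: ennreal_plus)
  then show ?thesis by (simp add: nn_integral_add)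
qed

text \<open>Continuity gives convergence of the smears at every point as the variance shrinks, and
  the bound on \<open>u\<close> supplies the dominating function. Half of \<open>e\<close> pays for
  the convolution, half for quantising its centres.\<close>

lemma bounded_continuous_L1_approx:
  fixes u :: "real^'n \<Rightarrow> real"
  assumes u: "integrable lborel u" "\<And>x. 0 \<le> u x" and bd: "\<And>x. u x \<le> B"
    and cont: "continuous_on UNIV u" and e: "0 < (e::real)"
  obtains g where "g \<in> iso_gauss_combinations" "(\<integral>\<^sup>+x. ennreal \<bar>g x - u x\<bar> \<partial>lborel) < e"
proof -
  have [measurable]: "u \<in> borel_measurable borel" using u(1) by auto
  have p: "pos_def_matrix (mat 1 :: real^'n^'n)" by (rule pos_def_scalar) simp
  \<comment> \<open>Squares, so that the standard deviation appearing in
    \<open>smear_substitution\<close> is simply 1 / (n + 1).\<close>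
  define s where "s n = (1 / real (Suc n))\<^sup>2" for n
  have s: "0 < s n" for n by (simp add: s_def)
  have lim: "(\<lambda>n. smear u (s n) (\<lambda>y. y) x) \<longlonglongrightarrow> u x" for x
  proof -
    have "(\<lambda>n. \<integral>z. u (x + sqrt (s n) *\<^sub>R z) * gauss_density 0 (mat 1) z \<partial>lborel)
        \<longlonglongrightarrow> (\<integral>z. u x * gauss_density 0 (mat 1) (z :: real^'n) \<partial>lborel)"
    proof (rule integral_dominated_convergence)
      show "integrable lborel (\<lambda>z :: real^'n. B * gauss_density 0 (mat 1) z)"
        by (intro integrable_mult_right integrable_std_gauss)
      show "AE z in lborel. norm (u (x + sqrt (s n) *\<^sub>R z) * gauss_density 0 (mat 1) z) \<le> B * gauss_density 0 (mat 1) z" for n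
        using u(2) bd less_imp_le[OF gauss_density_pos[OF p]]
        by (intro AE_I2) (simp add: abs_mult mult_right_mono)
      have "(\<lambda>n. u (x + sqrt (s n) *\<^sub>R z)) \<longlonglongrightarrow> u x" for z
      proof (rule continuous_on_tendsto_compose[OF cont])
        have "(\<lambda>n. x + (1 / real (Suc n)) *\<^sub>R z) \<longlonglongrightarrow> x + 0 *\<^sub>R z"
          by (intro tendsto_intros LIMSEQ_Suc[OF lim_1_over_n])
        then show "(\<lambda>n. x + sqrt (s n) *\<^sub>R z) \<longlonglongrightarrow> x" by (simp add: s_def)
      qed auto
      then show "AE z in lborel. (\<lambda>n. u (x + sqrt (s n) *\<^sub>R z) * gauss_density 0 (mat 1) z) \<longlonglongrightarrow> u x * gauss_density 0 (mat 1) z"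
        by (intro AE_I2 tendsto_mult tendsto_const)
    qed auto
    then show ?thesis
      by (simp add: smear_substitution[OF u s] integral_std_gauss)
  qed
  have "(\<lambda>n. \<integral>\<^sup>+x. norm (smear u (s n) (\<lambda>y. y) x - u x) \<partial>lborel) \<longlonglongrightarrow> 0"
  proof (rule Scheffe_lemma2)
    show "(\<integral>\<^sup>+x. norm (smear u (s n) (\<lambda>y. y) x) \<partial>lborel) \<le> (\<integral>\<^sup>+x. norm (u x) \<partial>lborel)" for n
      using u(2) by (simp add: smear_nonneg[OF u s] nn_integral_smear[OF u s])
  qed (use lim u borel_measurable_smear[OF u s] in auto)
  from order_tendstoD(2)[OF this, of "ennreal (e / 2)"] e
  obtain n where n: "(\<integral>\<^sup>+x. ennreal \<bar>smear u (s n) (\<lambda>y. y) x - u x\<bar> \<partial>lborel) < ennreal (e / 2)"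
    by (auto simp: eventually_sequentially)
  obtain g where g: "g \<in> iso_gauss_combinations"
    "(\<integral>\<^sup>+x. ennreal \<bar>g x - smear u (s n) (\<lambda>y. y) x\<bar> \<partial>lborel) < ennreal (e / 2)"
    using smear_L1_approx[OF u s, of "ennreal (e / 2)" n] e by auto
  have "(\<integral>\<^sup>+x. ennreal \<bar>g x - u x\<bar> \<partial>lborel) \<le> (\<integral>\<^sup>+x. ennreal \<bar>g x - smear u (s n) (\<lambda>y. y) x\<bar> \<partial>lborel)
      + (\<integral>\<^sup>+x. ennreal \<bar>smear u (s n) (\<lambda>y. y) x - u x\<bar> \<partial>lborel)"
    using borel_measurable_iso_gauss_combinations[OF g(1)] borel_measurable_smear[OF u s]
    by (intro L1_triangle) auto
  also have "\<dots> < ennreal (e / 2) + ennreal (e / 2)"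
    using g(2) n by (rule add_strict_mono)
  also have "\<dots> = ennreal e" using e by (simp add: ennreal_plus[symmetric] del: ennreal_plus)
  finally show ?thesis using g(1) that by blast
qed

text \<open>Truncation in height and space comes first: it makes a multiple of an integrable cutoff
  available as majorant when the truncated function is approximated by continuous ones that converge
  only almost everywhere.\<close>

lemma integrable_L1_approx_continuous:
  fixes f :: "real^'n \<Rightarrow> real"
  assumes f: "integrable lborel f" "\<And>x. 0 \<le> f x" and e: "0 < (e::real)"
  obtains u B where "integrable lborel u" "\<And>x. 0 \<le> u x" "\<And>x. u x \<le> B" "continuous_on UNIV u"
    "(\<integral>\<^sup>+x. ennreal \<bar>u x - f x\<bar> \<partial>lborel) < e"
proof -
  have mf[measurable]: "f \<in> borel_measurable borel" using f(1) by auto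
  \<comment> \<open>A continuous cutoff: 1 on the ball of radius k, 0 outside the ball of radius k +
    1.\<close>
  define \<beta> where "\<beta> k x = max 0 (min 1 (real k + 1 - norm x))" for k and x :: "real^'n"
  have \<beta>: "0 \<le> \<beta> k x" "\<beta> k x \<le> 1" for k x by (auto simp: \<beta>_def)
  have c\<beta>: "continuous_on UNIV (\<beta> k)" for k unfolding \<beta>_def by (intro continuous_intros)
  then have [measurable]: "\<beta> k \<in> borel_measurable borel" for k by (rule borel_measurable_continuous_onI)
  have i\<beta>: "integrable lborel (\<beta> k)" for k
  proof (rule Bochner_Integration.integrable_bound)
    show "integrable lborel (indicator (cball 0 (real k + 1)) :: real^'n \<Rightarrow> real)"
      using emeasure_lborel_cball_finite[of "0 :: real^'n" "real k + 1"]
      by (intro integrable_real_indicator) auto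
    show "AE x in lborel. norm (\<beta> k x) \<le> norm (indicator (cball 0 (real k + 1)) x :: real)"
      by (intro AE_I2) (auto simp: \<beta>_def indicator_def)
  qed simp
  define t where "t k x = min (f x) (real k) * \<beta> k x" for k x
  have t: "0 \<le> t k x" "t k x \<le> f x" for k x
    using f(2)[of x] \<beta>[of k x] mult_mono[of "min (f x) (real k)" "f x" "\<beta> k x" 1] by (auto simp: t_def)
  have [measurable]: "t k \<in> borel_measurable borel" for k unfolding t_def by measurable
  have "(\<lambda>k. \<integral>\<^sup>+x. norm (t k x - f x) \<partial>lborel) \<longlonglongrightarrow> 0"
  proof (rule Scheffe_lemma2)
    show "AE x in lborel. (\<lambda>k. t k x) \<longlonglongrightarrow> f x"
    proof (intro AE_I2 tendsto_eventually)
      fix x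
      obtain k0 where k0: "max (f x) (norm x) \<le> real k0" using real_arch_simple by blast
      show "\<forall>\<^sub>F k in sequentially. t k x = f x"
        using eventually_ge_at_top[of k0]
      proof eventually_elim
        case (elim k)
        then have "real k0 \<le> real k" by simp
        then have "f x \<le> real k" "norm x \<le> real k" using k0 by auto
        then show ?case by (simp add: t_def \<beta>_def)
      qed
    qed
    show "(\<integral>\<^sup>+x. norm (t k x) \<partial>lborel) \<le> (\<integral>\<^sup>+x. norm (f x) \<partial>lborel)" for k
      using t f(2) by (intro nn_integral_mono ennreal_leI) simp
  qed (use f in auto)
  from order_tendstoD(2)[OF this, of "ennreal (e / 2)"] e
  obtain k where k: "(\<integral>\<^sup>+x. ennreal \<bar>t k x - f x\<bar> \<partial>lborel) < ennreal (e / 2)"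
    by (auto simp: eventually_sequentially)
  \<comment> \<open>In this sense measurability means being the limit of continuous functions off a
    negligible set. Clipping them to [0, k] and multiplying by the cutoff preserves continuity and
    convergence and adds the majorant.\<close>
  have "f measurable_on UNIV"
    by (rule lebesgue_measurable_imp_measurable_on) (auto intro: measurable_completion)
  then obtain N g where N: "negligible N" and g: "\<And>n. continuous_on UNIV (g n)"
    "\<And>x. x \<notin> N \<Longrightarrow> (\<lambda>n. g n x :: real) \<longlonglongrightarrow> f x"
    unfolding measurable_on_def by auto
  have "AE x in lebesgue. x \<notin> N" using N by (intro AE_not_in) (simp add: negligible_iff_null_sets)
  then have aeN: "AE x in lborel. x \<notin> N" by (simp add: AE_completion_iff)
  have [measurable]: "g n \<in> borel_measurable borel" for n using g(1) by (rule borel_measurable_continuous_onI)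
  define u where "u n x = max 0 (min (g n x) (real k)) * \<beta> k x" for n x
  have u: "0 \<le> u n x" "u n x \<le> real k * \<beta> k x" for n x
    using \<beta>[of k x] by (auto simp: u_def intro: mult_right_mono)
  have cu: "continuous_on UNIV (u n)" for n
    unfolding u_def by (intro continuous_intros g(1) c\<beta>)
  have [measurable]: "u n \<in> borel_measurable borel" for n using cu by (rule borel_measurable_continuous_onI)
  have "(\<lambda>n. \<integral>\<^sup>+x. ennreal \<bar>u n x - t k x\<bar> \<partial>lborel) \<longlonglongrightarrow> (\<integral>\<^sup>+x. 0 \<partial>(lborel :: (real^'n) measure))"
  proof (rule nn_integral_dominated_convergence)
    show "(\<integral>\<^sup>+x. ennreal (real k * \<beta> k x) \<partial>lborel) < \<infinity>"
      using i\<beta>[of k] \<beta> by (subst nn_integral_eq_integral) auto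
    show "AE x in lborel. ennreal \<bar>u n x - t k x\<bar> \<le> ennreal (real k * \<beta> k x)" for n
    proof (intro AE_I2 ennreal_leI)
      fix x
      have "t k x \<le> real k * \<beta> k x" using \<beta>[of k x] by (simp add: t_def mult_right_mono)
      then show "\<bar>u n x - t k x\<bar> \<le> real k * \<beta> k x" using u[of n x] t(1)[of k x] by linarith
    qed
    show "AE x in lborel. (\<lambda>n. ennreal \<bar>u n x - t k x\<bar>) \<longlonglongrightarrow> 0"
      using aeN
    proof eventually_elim
      case (elim x)
      have "(\<lambda>n. ennreal \<bar>u n x - t k x\<bar>) \<longlonglongrightarrow> ennreal \<bar>max 0 (min (f x) (real k)) * \<beta> k x - t k x\<bar>"
        unfolding u_def by (intro tendsto_intros g(2)[OF elim] tendsto_ennrealI)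
      then show ?case using f(2)[of x] by (simp add: t_def)
    qed
  qed auto
  then have "(\<lambda>n. \<integral>\<^sup>+x. ennreal \<bar>u n x - t k x\<bar> \<partial>lborel) \<longlonglongrightarrow> 0" by simp
  from order_tendstoD(2)[OF this, of "ennreal (e / 2)"] e
  obtain n where n: "(\<integral>\<^sup>+x. ennreal \<bar>u n x - t k x\<bar> \<partial>lborel) < ennreal (e / 2)"
    by (auto simp: eventually_sequentially)
  have "(\<integral>\<^sup>+x. ennreal \<bar>u n x - f x\<bar> \<partial>lborel) \<le>
      (\<integral>\<^sup>+x. ennreal \<bar>u n x - t k x\<bar> \<partial>lborel) + (\<integral>\<^sup>+x. ennreal \<bar>t k x - f x\<bar> \<partial>lborel)"
    by (intro L1_triangle) auto
  also have "\<dots> < ennreal (e / 2) + ennreal (e / 2)" using n k by (rule add_strict_mono)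
  also have "\<dots> = ennreal e" using e by (simp add: ennreal_plus[symmetric] del: ennreal_plus)
  finally have close: "(\<integral>\<^sup>+x. ennreal \<bar>u n x - f x\<bar> \<partial>lborel) < e" .
  show ?thesis
  proof (rule that[of "u n" "real k"])
    show "integrable lborel (u n)"
      by (rule Bochner_Integration.integrable_bound[where f="\<lambda>x. real k * \<beta> k x"])
        (use i\<beta> u \<beta> in \<open>auto simp: abs_mult\<close>)
    show "u n x \<le> real k" for x
      using u(2)[of n x] mult_left_mono[OF \<beta>(2), of "real k" k x] by simp
  qed (use u cu close in auto)
qed

text \<open>The mass of each approximant differs from 1 by at most its L1 error, so dividing by the
  mass does not disturb the limit; L1 convergence yields almost everywhere convergence along a
  subsequence.\<close>

theorem density_AE_limit_of_gauss_mixtures: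
  fixes f :: "real^'n \<Rightarrow> real"
  assumes f: "is_density f"
  obtains g where "\<And>n. g n \<in> gauss_mixtures" "AE x in lborel. (\<lambda>n::nat. g n x) \<longlonglongrightarrow> f x"
proof -
  have [measurable]: "f \<in> borel_measurable borel" and f0: "\<And>x. 0 \<le> f x"
    and f1: "(\<integral>\<^sup>+x. ennreal (f x) \<partial>lborel) = 1"
    using f by (auto simp: is_density_def)
  have "has_bochner_integral lborel f 1"
    by (rule has_bochner_integral_nn_integral) (auto simp: f0 f1)
  then have fi: "integrable lborel f" and fI: "(\<integral>x. f x \<partial>lborel) = 1" by (auto simp: has_bochner_integral_iff)
  have approx: "\<exists>g \<in> iso_gauss_combinations. (\<integral>\<^sup>+x. ennreal \<bar>g x - f x\<bar> \<partial>lborel) < ennreal e" if e: "0 < e" for e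
  proof -
    obtain u B where u: "integrable lborel u" "\<And>x. 0 \<le> u x" "\<And>x. u x \<le> B" "continuous_on UNIV u"
      and uf: "(\<integral>\<^sup>+x. ennreal \<bar>u x - f x\<bar> \<partial>lborel) < ennreal (e / 2)"
      using integrable_L1_approx_continuous[OF fi f0, of "e / 2"] e by auto
    obtain g where g: "g \<in> iso_gauss_combinations" "(\<integral>\<^sup>+x. ennreal \<bar>g x - u x\<bar> \<partial>lborel) < ennreal (e / 2)"
      using bounded_continuous_L1_approx[OF u, of "e / 2"] e by auto
    have "(\<integral>\<^sup>+x. ennreal \<bar>g x - f x\<bar> \<partial>lborel) \<le>
        (\<integral>\<^sup>+x. ennreal \<bar>g x - u x\<bar> \<partial>lborel) + (\<integral>\<^sup>+x. ennreal \<bar>u x - f x\<bar> \<partial>lborel)"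
      using borel_measurable_iso_gauss_combinations[OF g(1)] u(1) by (intro L1_triangle) auto
    also have "\<dots> < ennreal (e / 2) + ennreal (e / 2)" using g(2) uf by (rule add_strict_mono)
    also have "\<dots> = ennreal e" using e by (simp add: ennreal_plus[symmetric] del: ennreal_plus)
    finally show ?thesis using g(1) by blast
  qed
  \<comment> \<open>The 2 in the denominator keeps every error strictly below 1, already at n = 0,
    so that each mass \<open>W n\<close> is positive.\<close>
  define d where "d n = 1 / (real n + 2)" for n
  have d: "0 < d n" "d n < 1" for n by (auto simp: d_def)
  have d_lim: "d \<longlonglongrightarrow> 0" unfolding d_def by real_asymp
  from approx[OF d(1)] obtain s where s: "\<And>n. s n \<in> iso_gauss_combinations"
    and sf: "\<And>n. (\<integral>\<^sup>+x. ennreal \<bar>s n x - f x\<bar> \<partial>lborel) < ennreal (d n)"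
    by metis
  have [measurable]: "s n \<in> borel_measurable borel" for n
    by (rule borel_measurable_iso_gauss_combinations[OF s])
  have diff: "integrable lborel (\<lambda>x. s n x - f x)" for n
    using sf[of n] by (intro integrableI_bounded) (auto intro: less_trans)
  then have si: "integrable lborel (s n)" for n
    using Bochner_Integration.integrable_add[OF diff[of n] fi] by simp
  have L1: "(\<integral>x. norm (s n x - f x) \<partial>lborel) < d n" for n
  proof -
    have "ennreal (\<integral>x. norm (s n x - f x) \<partial>lborel) < ennreal (d n)"
      using sf[of n] diff[of n] by (subst nn_integral_eq_integral[symmetric]) auto
    then show ?thesis by (simp add: ennreal_less_iff)
  qed
  define W where "W n = (\<integral>x. s n x \<partial>lborel)" for n
  have W1: "\<bar>W n - 1\<bar> < d n" for n
  proof -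
    have "W n - 1 = (\<integral>x. s n x - f x \<partial>lborel)" using si[of n] fi fI by (simp add: W_def)
    then have "\<bar>W n - 1\<bar> \<le> (\<integral>x. norm (s n x - f x) \<partial>lborel)" by simp
    also have "\<dots> < d n" by (rule L1)
    finally show ?thesis .
  qed
  have Wpos: "0 < W n" for n using W1[of n] d(2)[of n] by linarith
  have "(\<lambda>n. \<bar>W n - 1\<bar>) \<longlonglongrightarrow> 0"
    by (rule tendsto_sandwich[OF _ _ tendsto_const d_lim]) (simp_all add: less_imp_le[OF W1])
  then have W_lim: "W \<longlonglongrightarrow> 1" by (simp add: tendsto_rabs_zero_iff LIM_zero_cancel)
  have mix: "(\<lambda>x. s n x / W n) \<in> gauss_mixtures" for n
    by (rule iso_gauss_combinations_scale[OF s _ Wpos])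
      (simp add: W_def nn_integral_eq_integral[OF si] iso_gauss_combinations_nonneg[OF s])
  have "(\<lambda>n. \<integral>x. norm (s n x - f x) \<partial>lborel) \<longlonglongrightarrow> 0"
    by (rule tendsto_sandwich[OF _ _ tendsto_const d_lim]) (simp_all add: less_imp_le[OF L1[unfolded real_norm_def]])
  from tendsto_L1_AE_subseq[OF diff this] obtain r where r: "strict_mono r"
    and ae: "AE x in lborel. (\<lambda>n. s (r n) x - f x) \<longlonglongrightarrow> 0" by auto
  have W_lim': "(\<lambda>n. W (r n)) \<longlonglongrightarrow> 1" using LIMSEQ_subseq_LIMSEQ[OF W_lim r] by (simp add: o_def)
  show ?thesis
  proof (rule that[of "\<lambda>n x. s (r n) x / W (r n)"])
    show "AE x in lborel. (\<lambda>n. s (r n) x / W (r n)) \<longlonglongrightarrow> f x"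
      using ae
    proof eventually_elim
      case (elim x)
      then have "(\<lambda>n. s (r n) x) \<longlonglongrightarrow> f x" by (rule LIM_zero_cancel)
      from tendsto_divide[OF this W_lim'] show ?case by simp
    qed
  qed (rule mix)
qed

section \<open>Mixtures with arbitrarily small KL, and the equivalence\<close>

lemma gauss_mixtures_add_component:
  assumes g: "g \<in> gauss_mixtures" and \<delta>: "0 \<le> \<delta>" "\<delta> \<le> 1" and T: "pos_def_matrix T"
  shows "(\<lambda>x. (1 - \<delta>) * g x + \<delta> * gauss_density \<nu> T x) \<in> gauss_mixtures"
proof -
  obtain m w \<mu> S where w: "\<And>j. j < m \<Longrightarrow> 0 \<le> w j" "(\<Sum>j<m. w j) = 1"
    and S: "\<And>j. j < (m::nat) \<Longrightarrow> pos_def_matrix (S j)"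
    and g: "g = (\<lambda>x. \<Sum>j<m. w j * gauss_density (\<mu> j) (S j) x)"
    using g unfolding gauss_mixtures_def by auto
  let ?w = "\<lambda>j. if j < m then (1 - \<delta>) * w j else \<delta>"
  let ?\<mu> = "\<lambda>j. if j < m then \<mu> j else \<nu>"
  let ?S = "\<lambda>j. if j < m then S j else T"
  have "(\<Sum>j<Suc m. ?w j) = 1" using w(2) by (simp add: sum_distrib_left[symmetric])
  moreover have "(1 - \<delta>) * g x + \<delta> * gauss_density \<nu> T x = (\<Sum>j<Suc m. ?w j * gauss_density (?\<mu> j) (?S j) x)" for x
    by (simp add: g sum_distrib_left mult.assoc)
  ultimately show ?thesis
    unfolding gauss_mixtures_def using w(1) S T \<delta>
    by (intro CollectI exI[of _ "Suc m"] exI[of _ ?w] exI[of _ ?\<mu>] exI[of _ ?S]) auto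
qed

theorem KL_gauss_mixtures_arbitrarily_small:
  fixes f :: "real^'n \<Rightarrow> real"
  assumes f: "is_density f"
    and moment: "(\<integral>\<^sup>+ x. ennreal ((norm x)\<^sup>2 * f x) \<partial>lborel) < \<infinity>"
    and entropy: "(\<integral>\<^sup>+ x. ennreal (f x * log_plus (f x)) \<partial>lborel) < \<infinity>"
    and e: "0 < e"
  shows "\<exists>g\<in>gauss_mixtures. KL f g < ereal e"
proof -
  have [measurable]: "f \<in> borel_measurable borel" and f0: "\<And>x. 0 \<le> f x"
    and f1: "(\<integral>\<^sup>+x. ennreal (f x) \<partial>lborel) = 1"
    using f by (auto simp: is_density_def)
  obtain s where s: "\<And>n. s n \<in> gauss_mixtures" and s_lim: "AE x in lborel. (\<lambda>n::nat. s n x) \<longlonglongrightarrow> f x"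
    using density_AE_limit_of_gauss_mixtures[OF f] by metis
  \<comment> \<open>Chosen so that the limiting bound log (1 / (1 - \<delta>)) equals e / 2, which
    leaves room for a strict inequality below e.\<close>
  define \<delta> where "\<delta> = 1 - exp (- e / 2)"
  have \<delta>: "0 < \<delta>" "\<delta> < 1" "ln (1 - \<delta>) = - e / 2" using e by (auto simp: \<delta>_def)
  define G where "G = (gauss_density 0 (mat 1) :: real^'n \<Rightarrow> real)"
  define k where "k = sqrt ((2 * pi) ^ CARD('n))"
  have k: "0 < k" by (simp add: k_def)
  have G: "G x = exp (- (norm x)\<^sup>2 / 2) / k" for x
    by (simp add: G_def gauss_density_scalar k_def)
  have G0: "0 < G x" for x using k by (simp add: G)
  define g where "g n x = (1 - \<delta>) * s n x + \<delta> * G x" for n x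
  have g: "g n \<in> gauss_mixtures" for n
    unfolding g_def[abs_def] G_def using s \<delta> by (intro gauss_mixtures_add_component pos_def_scalar) auto
  have [measurable]: "g n \<in> borel_measurable borel" for n by (rule borel_measurable_gauss_mixtures[OF g])
  have [measurable]: "G \<in> borel_measurable borel" unfolding G_def by measurable
  note g0 = gauss_mixtures_pos[OF g]
  \<comment> \<open>The pointwise limit of the \<open>g n\<close>. Its Gaussian part keeps it
    positive, so the logarithm is continuous there.\<close>
  define v where "v x = (1 - \<delta>) * f x + \<delta> * G x" for x
  have v0: "0 < v x" for x
    using f0[of x] G0[of x] \<delta> by (auto simp: v_def intro!: add_nonneg_pos)
  have [measurable]: "v \<in> borel_measurable borel" unfolding v_def by measurable
  define c where "c = \<bar>ln \<delta>\<bar> + \<bar>ln k\<bar>"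
  have c: "0 \<le> c" by (simp add: c_def)
  define b where "b x = f x * log_plus (f x) + c * f x + (norm x)\<^sup>2 * f x" for x
  have bound: "f x * ln (f x / g n x) \<le> b x" for n x
  proof (cases "f x = 0")
    case False
    then have fx: "0 < f x" using f0[of x] by simp
    have "\<delta> * G x \<le> g n x"
      using gauss_mixtures_pos[OF s, of n x] \<delta> by (simp add: g_def)
    then have "ln (\<delta> * G x) \<le> ln (g n x)" using \<delta> G0 by (intro ln_mono) auto
    moreover have "ln (\<delta> * G x) = ln \<delta> - (norm x)\<^sup>2 / 2 - ln k"
      using \<delta> k by (simp add: G ln_mult ln_div)
    moreover have "ln (f x / g n x) = ln (f x) - ln (g n x)"
      using fx g0[of n x] by (simp add: ln_div)
    moreover have "ln (f x) \<le> log_plus (f x)" by (simp add: log_plus_def)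
    moreover have "0 \<le> (norm x)\<^sup>2" by simp
    ultimately have "ln (f x / g n x) \<le> log_plus (f x) + c + (norm x)\<^sup>2"
      unfolding c_def by linarith
    then have "f x * ln (f x / g n x) \<le> f x * (log_plus (f x) + c + (norm x)\<^sup>2)"
      using fx by simp
    then show ?thesis by (simp add: b_def algebra_simps)
  qed (simp add: b_def)
  \<comment> \<open>The majorant bounds f ln (f / g_n) from above only. Since \<open>ennreal\<close>
    truncates at 0, the convergence concerns the positive parts, and these alone bound KL from
    above.\<close>
  have "(\<lambda>n. \<integral>\<^sup>+x. ennreal (f x * ln (f x / g n x)) \<partial>lborel) \<longlonglongrightarrow> (\<integral>\<^sup>+x. ennreal (f x * ln (f x / v x)) \<partial>lborel)"
  proof (rule nn_integral_dominated_convergence)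
    have "(\<integral>\<^sup>+x. ennreal (b x) \<partial>lborel) = (\<integral>\<^sup>+x. ennreal (f x * log_plus (f x)) + ennreal c * ennreal (f x) + ennreal ((norm x)\<^sup>2 * f x) \<partial>lborel)"
      using f0 c by (intro nn_integral_cong) (simp add: b_def ennreal_plus ennreal_mult log_plus_def)
    also have "\<dots> = (\<integral>\<^sup>+x. ennreal (f x * log_plus (f x)) \<partial>lborel) + ennreal c + (\<integral>\<^sup>+x. ennreal ((norm x)\<^sup>2 * f x) \<partial>lborel)"
      by (simp add: nn_integral_add nn_integral_cmult f1 log_plus_def)
    also have "\<dots> < \<infinity>" using moment entropy by simp
    finally show "(\<integral>\<^sup>+x. ennreal (b x) \<partial>lborel) < \<infinity>" .
    show "(\<lambda>x. ennreal (b x)) \<in> borel_measurable lborel" by (simp add: b_def log_plus_def)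
    show "AE x in lborel. ennreal (f x * ln (f x / g n x)) \<le> ennreal (b x)" for n
      by (intro AE_I2 ennreal_leI bound)
    show "AE x in lborel. (\<lambda>n. ennreal (f x * ln (f x / g n x))) \<longlonglongrightarrow> ennreal (f x * ln (f x / v x))"
      using s_lim
    proof eventually_elim
      case (elim x)
      show ?case
      proof (cases "f x = 0")
        case False
        have "(\<lambda>n. g n x) \<longlonglongrightarrow> v x"
          unfolding g_def v_def by (intro tendsto_intros elim)
        then show ?thesis
          using v0[of x] False by (intro tendsto_ennrealI tendsto_intros) auto
      qed simp
    qed
  qed auto
  moreover have "(\<integral>\<^sup>+x. ennreal (f x * ln (f x / v x)) \<partial>lborel) < ennreal e"
  proof -
    have "(\<integral>\<^sup>+x. ennreal (f x * ln (f x / v x)) \<partial>lborel) \<le> (\<integral>\<^sup>+x. ennreal (e / 2) * ennreal (f x) \<partial>lborel)"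
    proof (intro nn_integral_mono)
      fix x
      have "f x * ln (f x / v x) \<le> e / 2 * f x"
      proof (cases "f x = 0")
        case False
        then have fx: "0 < f x" using f0[of x] by simp
        have "(1 - \<delta>) * f x \<le> v x" using \<delta> G0[of x] by (simp add: v_def)
        then have "ln ((1 - \<delta>) * f x) \<le> ln (v x)" using fx \<delta> by (intro ln_mono) auto
        then have "ln (f x / v x) \<le> e / 2"
          using fx v0[of x] \<delta> by (simp add: ln_mult ln_div)
        from mult_left_mono[OF this f0[of x]] show ?thesis by (simp add: mult.commute)
      qed simp
      then show "ennreal (f x * ln (f x / v x)) \<le> ennreal (e / 2) * ennreal (f x)"
        using e f0[of x] by (simp add: ennreal_mult[symmetric] ennreal_leI)
    qed
    also have "\<dots> = ennreal (e / 2)" by (simp add: nn_integral_cmult f1)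
    also have "\<dots> < ennreal e" using e by (simp add: ennreal_less_iff)
    finally show ?thesis .
  qed
  ultimately have "\<forall>\<^sub>F n in sequentially. (\<integral>\<^sup>+x. ennreal (f x * ln (f x / g n x)) \<partial>lborel) < ennreal e"
    by (rule order_tendstoD(2))
  then obtain n where n: "(\<integral>\<^sup>+x. ennreal (f x * ln (f x / g n x)) \<partial>lborel) < ennreal e"
    by (auto simp: eventually_sequentially)
  have "KL f (g n) \<le> enn2ereal (\<integral>\<^sup>+x. ennreal (f x * ln (f x / g n x)) \<partial>lborel)"
    unfolding KL_eq_of_pos[of "g n", OF g0] by (simp add: ereal_diff_le_self)
  also have "\<dots> < enn2ereal (ennreal e)" using n by (simp add: less_ennreal.rep_eq)
  also have "\<dots> = ereal e" using e by (simp add: enn2ereal_ennreal)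
  finally show ?thesis using g by blast
qed

theorem mainTheorem14:
  fixes f :: "real^'n \<Rightarrow> real"
  assumes "f \<in> F_CSSA"
  shows "(INF g \<in> gauss_mixtures. KL f g) = 0 \<longleftrightarrow>
         (\<integral>\<^sup>+ x. ennreal ((norm x)\<^sup>2 * f x) \<partial>lborel) < \<infinity>"
proof
  have f: "is_density f" using assms by (simp add: F_CSSA_def)
  show "(\<integral>\<^sup>+ x. ennreal ((norm x)\<^sup>2 * f x) \<partial>lborel) < \<infinity>" if "(INF g \<in> gauss_mixtures. KL f g) = 0"
  proof -
    \<comment> \<open>The value 1 is arbitrary: what is wanted is one mixture at finite divergence
      from f.\<close>
    have "(INF g \<in> gauss_mixtures. KL f g) < 1" using that by simp
    then obtain g where "g \<in> gauss_mixtures" "KL f g < 1" by (auto simp: INF_less_iff)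
    then show ?thesis
      by (intro second_moment_finite_if_KL_finite[OF f, of g]) (auto intro: less_trans)
  qed
  show "(INF g \<in> gauss_mixtures. KL f g) = 0"
    if moment: "(\<integral>\<^sup>+ x. ennreal ((norm x)\<^sup>2 * f x) \<partial>lborel) < \<infinity>"
  proof (rule antisym)
    show "(INF g \<in> gauss_mixtures. KL f g) \<le> 0"
    proof (rule ereal_le_epsilon2)
      fix e :: real assume "0 < e"
      then obtain g where "g \<in> gauss_mixtures" "KL f g < ereal e"
        using KL_gauss_mixtures_arbitrarily_small[OF f moment F_CSSA_log_plus_integrable[OF assms]] by blast
      then show "(INF g \<in> gauss_mixtures. KL f g) \<le> 0 + ereal e"
        by (auto intro: INF_lower2)
    qed
    show "0 \<le> (INF g \<in> gauss_mixtures. KL f g)"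
      by (intro INF_greatest KL_gauss_mixture_nonneg[OF f])
  qed
qed

end
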